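(* Let $a=\frac pq\in(0,\frac12)$ be rational ($p,q$ positive integers), $b\in(0,\frac12)$, and let $\theta$ be a non-exceptional direction for the billiard in the square table with one-sided mirror $I=\{a\}\times[0,b]$. Then the interval translation map $S$ defined in the context (equivalently, the billiard in direction $\theta$) has at most $q$ minimal components, and on each minimal component the number of ergodic invariant measures for the interval translation map/billiard is at most $1+2q$.
   Context: Billiard: the table is the square $[0,\frac12]\times[0,\frac12]$ with a vertical wall $I=\{a\}\times[0,b]$. A point particle moves at unit speed along straight lines; at the boundary of the square it is reflected by the usual law. If it arrives at $I$ from the left it passes through unperturbed; if it arrives at $I$ from the right it is reflected by the usual law. A direction $\theta$ is exceptional if there is a billiard orbit in direction $\theta$ from an end point of $I$ to an end point of $I$ (vertical directions are exceptional); otherwise it is non-exceptional. The billiard unfolds to a linear flow on the unit torus $\mathbb R^2/\mathbb Z^2$ with slits $\{a\}\times[-b,b]$ and $\{1-a\}\times[-b,b]$, where a trajectory reaching the reflecting copy jumps from the slit at $x=1-a$ to the slit at $x=a$. The return map $S$ to the union of vertical sections $x=\frac kq$, $k\in\{0,1,\dots,q-1\}$ (the section $x=\frac kq$ being $\{k\}\times\mathbb R/\mathbb Z$) is $$S(i,y)=\begin{cases}(p,\ y+\tan\theta/q \bmod 1)&\text{if } i=q-p \text{ and } y\in[-b,b],\\ (i+1 \bmod q,\ y+\tan\theta/q \bmod 1)&\text{otherwise.}\end{cases}$$ A minimal component is an $\omega$-limit set of $S$ in which every orbit is dense. Invariant measures are Borel probability measures. *)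

theory Defs
  imports "HOL-Probability.Probability"
begin

subsection \<open>The billiard with a one-sided mirror\<close>

definition table :: "(real \<times> real) set" where
  "table = {0..1/2} \<times> {0..1/2}"

definition mirror_endpoints :: "real \<Rightarrow> real \<Rightarrow> (real \<times> real) set" where
  "mirror_endpoints a b = {(a, 0), (a, b)}"

text \<open>Outgoing velocity after arriving at a point with velocity \<open>(u, v)\<close>. The horizontal component
  is reversed at the vertical sides and at the mirror \<open>{a} \<times> [0, b]\<close> when the latter is reached
  from the right (\<open>u < 0\<close>); a mirror reached from the left is ignored. At a corner of the square both
  components are reversed, in accordance with the unfolding to the torus.\<close>

definition collide :: "real \<Rightarrow> real \<Rightarrow> real \<times> real \<Rightarrow> real \<times> real \<Rightarrow> real \<times> real" where
  "collide a b = (\<lambda>(x, y) (u, v).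
     (if x = 0 \<and> u < 0 \<or> x = 1/2 \<and> u > 0 \<or> x = a \<and> y \<in> {0..b} \<and> u < 0 then - u else u,
      if y = 0 \<and> v < 0 \<or> y = 1/2 \<and> v > 0 then - v else v))"

text \<open>Reflections in horizontal and vertical lines turn the direction \<open>\<theta>\<close> into
  \<open>\<plusminus>\<theta>\<close> and \<open>\<pi> \<plusminus> \<theta>\<close>; the billiard in direction \<open>\<theta>\<close> consists of the orbits moving in
  these directions.\<close>

definition directions :: "real \<Rightarrow> (real \<times> real) set" where
  "directions \<theta> = {cos \<theta>, - cos \<theta>} \<times> {sin \<theta>, - sin \<theta>}"

definition billiard_orbit :: "real \<Rightarrow> real \<Rightarrow> real \<Rightarrow> real \<Rightarrow> (real \<Rightarrow> real \<times> real) \<Rightarrow> bool" where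
  "billiard_orbit a b \<theta> T \<gamma> \<longleftrightarrow>
     0 < T \<and> \<gamma> ` {0..T} \<subseteq> table \<and>
     (\<exists>w\<in>directions \<theta>. \<exists>\<epsilon>>0. \<forall>s\<in>{0..\<epsilon>}. \<gamma> s = \<gamma> 0 + s *\<^sub>R w) \<and>
     (\<forall>t\<in>{0<..<T}. \<exists>w\<in>directions \<theta>. \<exists>\<epsilon>>0. \<forall>s\<in>{0..\<epsilon>}.
        \<gamma> (t - s) = \<gamma> t - s *\<^sub>R w \<and> \<gamma> (t + s) = \<gamma> t + s *\<^sub>R collide a b (\<gamma> t) w) \<and>
     (\<exists>w\<in>directions \<theta>. \<exists>\<epsilon>>0. \<forall>s\<in>{0..\<epsilon>}. \<gamma> (T - s) = \<gamma> T - s *\<^sub>R w)"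

definition exceptional :: "real \<Rightarrow> real \<Rightarrow> real \<Rightarrow> bool" where
  "exceptional a b \<theta> \<longleftrightarrow>
     cos \<theta> = 0 \<or>
     (\<exists>T \<gamma>. billiard_orbit a b \<theta> T \<gamma> \<and> \<gamma> 0 \<in> mirror_endpoints a b \<and> \<gamma> T \<in> mirror_endpoints a b)"


subsection \<open>The circle \<open>\<real>/\<int>\<close> with the quotient topology\<close>

quotient_type circle = real / "\<lambda>x y :: real. x - y \<in> \<int>"
  morphisms rep_circle to_circle
proof (rule equivpI)
  show "reflp (\<lambda>x y :: real. x - y \<in> \<int>)"
    by (simp add: reflp_def)
  show "symp (\<lambda>x y :: real. x - y \<in> \<int>)"
  proof (rule sympI)
    fix x y :: real
    assume "x - y \<in> \<int>"
    then have "- (x - y) \<in> \<int>" by (rule Ints_minus)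
    then show "y - x \<in> \<int>" by simp
  qed
  show "transp (\<lambda>x y :: real. x - y \<in> \<int>)"
  proof (rule transpI)
    fix x y z :: real
    assume "x - y \<in> \<int>" "y - z \<in> \<int>"
    then have "(x - y) + (y - z) \<in> \<int>" by (rule Ints_add)
    then show "x - z \<in> \<int>" by simp
  qed
qed

instantiation circle :: ab_group_add
begin

lift_definition zero_circle :: circle is 0 .

lift_definition plus_circle :: "circle \<Rightarrow> circle \<Rightarrow> circle" is "(+)"
  by (simp only: add_diff_add) (rule Ints_add)

lift_definition uminus_circle :: "circle \<Rightarrow> circle" is uminus
  by (simp only: minus_diff_minus) (rule Ints_minus)

definition minus_circle :: "circle \<Rightarrow> circle \<Rightarrow> circle" where
  "minus_circle x y = x + - y"

instance
proof
  fix x y z :: circle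
  show "x + y + z = x + (y + z)"
    by transfer (simp add: add.assoc)
  show "x + y = y + x"
    by transfer (simp add: add.commute)
  show "0 + x = x"
    by transfer simp
  show "- x + x = 0"
    by transfer simp
  show "x - y = x + - y"
    by (rule minus_circle_def)
qed

end

instantiation circle :: topological_space
begin

definition open_circle :: "circle set \<Rightarrow> bool" where
  "open_circle U \<longleftrightarrow> open (to_circle -` U)"

instance
proof
  show "open (UNIV :: circle set)"
    by (simp add: open_circle_def)
  show "open (U \<inter> V)" if "open U" "open V" for U V :: "circle set"
    using that by (simp add: open_circle_def open_Int)
  show "open (\<Union>K)" if "\<forall>U\<in>K. open U" for K :: "circle set set"
    using that by (auto simp: open_circle_def vimage_Union)
qed

end


subsection \<open>The interval translation map\<close>

definition sections :: "nat \<Rightarrow> (nat \<times> circle) set" where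
  "sections q = {..<q} \<times> UNIV"

definition itm :: "nat \<Rightarrow> nat \<Rightarrow> real \<Rightarrow> real \<Rightarrow> nat \<times> circle \<Rightarrow> nat \<times> circle" where
  "itm p q b \<theta> = (\<lambda>(i, y).
     (if i = q - p \<and> y \<in> to_circle ` {-b..b} then p else (i + 1) mod q,
      y + to_circle (tan \<theta> / real q)))"


subsection \<open>Minimal components and ergodic measures\<close>

definition omega_limit :: "('a :: topological_space \<Rightarrow> 'a) \<Rightarrow> 'a \<Rightarrow> 'a set" where
  "omega_limit T x = (\<Inter>N. closure {(T ^^ n) x |n. n \<ge> N})"

text \<open>As \<open>T\<close> need not be continuous, \<open>T\<close> may fail to map an \<open>\<omega>\<close>-limit set into itself. Density of an
  orbit in \<open>M\<close> is therefore expressed by inclusion of \<open>M\<close> in the orbit closure, without requiring the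
  orbit to stay in \<open>M\<close>.\<close>

definition minimal_component ::
    "'a :: topological_space set \<Rightarrow> ('a \<Rightarrow> 'a) \<Rightarrow> 'a set \<Rightarrow> bool" where
  "minimal_component X T M \<longleftrightarrow>
     (\<exists>x\<in>X. M = omega_limit T x) \<and> (\<forall>z\<in>M. M \<subseteq> closure (range (\<lambda>n. (T ^^ n) z)))"

definition invariant_measure :: "('a :: topological_space \<Rightarrow> 'a) \<Rightarrow> 'a measure \<Rightarrow> bool" where
  "invariant_measure T \<mu> \<longleftrightarrow>
     sets \<mu> = sets borel \<and> prob_space \<mu> \<and>
     (\<forall>A\<in>sets borel. emeasure \<mu> (T -` A) = emeasure \<mu> A)"

definition ergodic_measure :: "('a :: topological_space \<Rightarrow> 'a) \<Rightarrow> 'a measure \<Rightarrow> bool" where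
  "ergodic_measure T \<mu> \<longleftrightarrow>
     invariant_measure T \<mu> \<and>
     (\<forall>A\<in>sets borel. T -` A = A \<longrightarrow> emeasure \<mu> A = 0 \<or> emeasure \<mu> A = 1)"

definition ergodic_measures_on :: "('a :: topological_space \<Rightarrow> 'a) \<Rightarrow> 'a set \<Rightarrow> 'a measure set" where
  "ergodic_measures_on T M = {\<mu>. ergodic_measure T \<mu> \<and> emeasure \<mu> M = 1}"

end

theory Submission
  imports Defs
begin

text \<open>The map \<open>S\<close> is a skew product over the rotation of the circle by \<open>\<alpha> = tan \<theta> / q\<close> with fibres of \<open>q\<close> points.
  If \<open>tan \<theta>\<close> were rational, there would be a closed billiard orbit, and pushing it parallel to itself until it
  touches an end point of the mirror would give an orbit from end point to end point; so \<open>\<alpha>\<close> is irrational. Over a circle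
  point whose rotation orbit avoids the discontinuities, every minimal component has a fibre point and is the closure of its
  orbit, which leaves at most \<open>q\<close> components. Invariant measures project to the unique
  rotation-invariant measure, and distinct ergodic measures live on disjoint sets; as each of these sets meets almost every
  fibre, there are at most \<open>q \<le> 1 + 2 q\<close> ergodic measures.\<close>

section \<open>Folding\<close>

text \<open>The difficulty is the discontinuity of the map at the ends of the slit: an
  \<omega>-limit set need not be mapped into itself, so orbits cannot be followed inside it. Points
  over a rotation orbit that misses both ends are continuity points at every time, and all but
  countably many circle points have this property. Finiteness of the fibre is what makes it meet
  every \<omega>-limit set: if each of its points had a neighbourhood that an orbit eventually
  avoids, then the projected orbit, which is dense, would eventually avoid an open set of the
  circle. The closed orbit in a rational direction comes from a common denominator. Between two
  arrivals at the mirror line from the right, the unfolded horizontal distance is 1 - 2a after a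
  reflection at the mirror and 1 otherwise. If \<open>a\<close> and \<open>tan \<theta>\<close> are
  rational, the heights of the arrivals take finitely many values modulo 1 and therefore
  repeat.\<close>

text \<open>\<open>tent\<close>, the distance to the nearest integer, folds a coordinate of the unfolded torus back to the table.\<close>

definition tent :: "real \<Rightarrow> real" where
  "tent x = \<bar>x - of_int (round x)\<bar>"

lemma tent_le_dist: "tent x \<le> \<bar>x - of_int m\<bar>"
  unfolding tent_def using round_diff_minimal[of x m] by simp

lemma tent_nonneg: "0 \<le> tent x"
  by (simp add: tent_def)

lemma tent_le_half: "tent x \<le> 1/2"
  unfolding tent_def using of_int_round_abs_le[of x] by (simp add: abs_minus_commute)

lemma tent_right: "tent x = x - of_int m" if "of_int m \<le> x" "x \<le> of_int m + 1/2"
proof (rule antisym)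
  show "tent x \<le> x - of_int m"
    using tent_le_dist[of x m] that by simp
  have "round x \<le> m \<or> m + 1 \<le> round x" by linarith
  then have "real_of_int (round x) \<le> of_int m \<or> of_int m + 1 \<le> real_of_int (round x)"
    by linarith
  then show "x - of_int m \<le> tent x"
    unfolding tent_def using that by (auto simp: abs_if)
qed

lemma tent_left: "tent x = of_int m - x" if "of_int m - 1/2 \<le> x" "x \<le> of_int m"
proof (rule antisym)
  show "tent x \<le> of_int m - x"
    using tent_le_dist[of x m] that by simp
  have "m \<le> round x \<or> round x \<le> m - 1" by linarith
  then have "of_int m \<le> real_of_int (round x) \<or> real_of_int (round x) \<le> of_int m - 1"
    by linarith
  then show "of_int m - x \<le> tent x"
    unfolding tent_def using that by (auto simp: abs_if)
qed

lemma tent_add_int [simp]: "tent (x + of_int m) = tent x"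
proof -
  have "round (x + of_int m) = round x + m"
    by (simp add: round_def add.assoc add.commute[of "of_int m"] flip: add.assoc)
       (metis add.assoc add.commute floor_add_int)
  then show ?thesis by (simp add: tent_def)
qed

lemma continuous_on_tent: "continuous_on S tent"
proof -
  have le: "tent x \<le> tent y + \<bar>x - y\<bar>" for x y
    using tent_le_dist[of x "round y"] unfolding tent_def[of y] by linarith
  have "1-lipschitz_on S tent"
  proof (rule lipschitz_onI)
    show "dist (tent x) (tent y) \<le> 1 * dist x y" for x y
      using le[of x y] le[of y x] by (simp add: dist_real_def abs_le_iff abs_minus_commute)
  qed simp
  then show ?thesis by (rule lipschitz_on_continuous_on)
qed

lemma continuous_on_tent_comp [continuous_intros]:
  "continuous_on S f \<Longrightarrow> continuous_on S (\<lambda>x. tent (f x))"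
  using continuous_on_compose2[OF continuous_on_tent[of UNIV]] by blast

text \<open>One-sided slopes of \<^const>\<open>tent\<close>, named as seen by a point moving to the right.\<close>

definition slope_in :: "real \<Rightarrow> real" where
  "slope_in x = (if 0 < frac x \<and> frac x \<le> 1/2 then 1 else -1)"

definition slope_out :: "real \<Rightarrow> real" where
  "slope_out x = (if frac x < 1/2 then 1 else -1)"

lemma tent_frac: "tent x = (if frac x \<le> 1/2 then frac x else 1 - frac x)"
proof -
  have "frac x < 1" "0 \<le> frac x" by (auto simp: frac_lt_1)
  then show ?thesis
    using tent_right[of "\<lfloor>x\<rfloor>" x] tent_left[of "\<lfloor>x\<rfloor> + 1" x] by (auto simp: frac_def)
qed

lemma small_step:
  fixes c d :: real assumes "0 < d" "0 \<le> c"
  obtains \<epsilon> where "\<epsilon> > 0" "\<And>s. s \<in> {0..\<epsilon>} \<Longrightarrow> 0 \<le> s * c \<and> s * c \<le> d"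
proof
  \<comment> \<open>The denominator is \<open>c + 1\<close> because the speed \<open>c\<close> may
    be 0, as for horizontal motion.\<close>
  show "0 < d / (c + 1)" using assms by simp
  fix s assume s: "s \<in> {0..d / (c + 1)}"
  then have "s * c \<le> d / (c + 1) * (c + 1)"
    using assms by (intro mult_mono) auto
  then show "0 \<le> s * c \<and> s * c \<le> d" using s assms by simp
qed

lemma tent_step_out:
  assumes "0 \<le> c"
  obtains \<epsilon> where "\<epsilon> > 0" "\<And>s. s \<in> {0..\<epsilon>} \<Longrightarrow> tent (x + s * c) = tent x + s * (c * slope_out x)"
proof (cases "frac x < 1/2")
  case True
  then have "0 < 1/2 - frac x" by simp
  then obtain e where e: "e > 0" "\<And>s. s \<in> {0..e} \<Longrightarrow> 0 \<le> s * c \<and> s * c \<le> 1/2 - frac x"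
    using small_step assms by metis
  have "tent (x + s * c) = tent x + s * (c * slope_out x)" if "s \<in> {0..e}" for s
  proof -
    have "of_int \<lfloor>x\<rfloor> \<le> x + s * c" using e(2)[OF that] of_int_floor_le[of x] by linarith
    then show ?thesis
      using e(2)[OF that] True tent_right[of "\<lfloor>x\<rfloor>" x] tent_right[of "\<lfloor>x\<rfloor>" "x + s * c"]
      by (auto simp: frac_def slope_out_def)
  qed
  then show thesis using that e(1) by blast
next
  case False
  have "0 < 1 - frac x" by (simp add: frac_lt_1)
  then obtain e where e: "e > 0" "\<And>s. s \<in> {0..e} \<Longrightarrow> 0 \<le> s * c \<and> s * c \<le> 1 - frac x"
    using small_step assms by metis
  have "tent (x + s * c) = tent x + s * (c * slope_out x)" if "s \<in> {0..e}" for s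
    using e(2)[OF that] False tent_left[of "\<lfloor>x\<rfloor> + 1" x] tent_left[of "\<lfloor>x\<rfloor> + 1" "x + s * c"]
    by (auto simp: frac_def slope_out_def)
  then show thesis using that e(1) by blast
qed

lemma tent_step_in:
  assumes "0 \<le> c"
  obtains \<epsilon> where "\<epsilon> > 0" "\<And>s. s \<in> {0..\<epsilon>} \<Longrightarrow> tent (x - s * c) = tent x - s * (c * slope_in x)"
proof -
  consider "frac x = 0" | "0 < frac x" "frac x \<le> 1/2" | "1/2 < frac x"
    using frac_ge_0[of x] by linarith
  then show thesis
  proof cases
    \<comment> \<open>To the left of an integer lies the descending branch of the preceding period,
      where \<open>frac\<close> is close to 1; this case therefore has to be split off.\<close>
    case 1
    obtain e where e: "e > 0" "\<And>s. s \<in> {0..e} \<Longrightarrow> 0 \<le> s * c \<and> s * c \<le> 1/2"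
      using small_step[of "1/2"] assms by (metis half_gt_zero zero_less_one)
    have "tent (x - s * c) = tent x - s * (c * slope_in x)" if "s \<in> {0..e}" for s
      using e(2)[OF that] 1 tent_left[of "\<lfloor>x\<rfloor>" x] tent_left[of "\<lfloor>x\<rfloor>" "x - s * c"]
      by (auto simp: frac_def slope_in_def)
    then show thesis using that e(1) by blast
  next
    case 2
    obtain e where e: "e > 0" "\<And>s. s \<in> {0..e} \<Longrightarrow> 0 \<le> s * c \<and> s * c \<le> frac x"
      using small_step[OF 2(1) assms] by metis
    have "tent (x - s * c) = tent x - s * (c * slope_in x)" if "s \<in> {0..e}" for s
      using e(2)[OF that] 2 tent_right[of "\<lfloor>x\<rfloor>" x] tent_right[of "\<lfloor>x\<rfloor>" "x - s * c"]
      by (auto simp: frac_def slope_in_def)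
    then show thesis using that e(1) by blast
  next
    case 3
    then have "0 < frac x - 1/2" by simp
    then obtain e where e: "e > 0" "\<And>s. s \<in> {0..e} \<Longrightarrow> 0 \<le> s * c \<and> s * c \<le> frac x - 1/2"
      using small_step assms by metis
    have "tent (x - s * c) = tent x - s * (c * slope_in x)" if "s \<in> {0..e}" for s
      using e(2)[OF that] 3 frac_lt_1[of x]
        tent_left[of "\<lfloor>x\<rfloor> + 1" x] tent_left[of "\<lfloor>x\<rfloor> + 1" "x - s * c"]
      by (auto simp: frac_def slope_in_def)
    then show thesis using that e(1) by blast
  qed
qed

text \<open>The kinks of \<open>tent\<close> are where its value is 0 or 1/2, that is, where the
  folded point is on a side of the table; the change of slope there is the reflection law. The
  factor \<open>c\<close> stays in the formula since a vanishing speed satisfies no strict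
  inequality.\<close>

lemma slope_out_reflect:
  assumes "0 \<le> c"
  shows "c * slope_out x =
    (if tent x = 0 \<and> c * slope_in x < 0 \<or> tent x = 1/2 \<and> c * slope_in x > 0
     then - (c * slope_in x) else c * slope_in x)"
  using assms frac_lt_1[of x] frac_ge_0[of x]
  by (cases "c = 0") (auto simp: tent_frac slope_in_def slope_out_def zero_less_mult_iff mult_less_0_iff
      dest: frac_eq_0_iff[THEN iffD2])

section \<open>Billiard orbits in rational directions\<close>

definition arrives :: "(real \<Rightarrow> real \<times> real) \<Rightarrow> real \<Rightarrow> real \<times> real \<Rightarrow> bool" where
  "arrives \<gamma> t w \<longleftrightarrow> (\<exists>\<epsilon>>0. \<forall>s\<in>{0..\<epsilon>}. \<gamma> (t - s) = \<gamma> t - s *\<^sub>R w)"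

definition departs :: "(real \<Rightarrow> real \<times> real) \<Rightarrow> real \<Rightarrow> real \<times> real \<Rightarrow> bool" where
  "departs \<gamma> t w \<longleftrightarrow> (\<exists>\<epsilon>>0. \<forall>s\<in>{0..\<epsilon>}. \<gamma> (t + s) = \<gamma> t + s *\<^sub>R w)"

text \<open>The common \<open>\<epsilon>\<close> for past and future can be split, as the smaller of
  two values serves both. Arrival and departure can then be transferred separately when orbits are
  glued.\<close>

lemma billiard_orbit_iff:
  "billiard_orbit a b \<theta> T \<gamma> \<longleftrightarrow>
     0 < T \<and> \<gamma> ` {0..T} \<subseteq> table \<and>
     (\<exists>w\<in>directions \<theta>. departs \<gamma> 0 w) \<and>
     (\<forall>t\<in>{0<..<T}. \<exists>w\<in>directions \<theta>. arrives \<gamma> t w \<and> departs \<gamma> t (collide a b (\<gamma> t) w)) \<and>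
     (\<exists>w\<in>directions \<theta>. arrives \<gamma> T w)"
proof -
  have "(arrives \<gamma> t w \<and> departs \<gamma> t w') \<longleftrightarrow>
    (\<exists>\<epsilon>>0. \<forall>s\<in>{0..\<epsilon>}. \<gamma> (t - s) = \<gamma> t - s *\<^sub>R w \<and> \<gamma> (t + s) = \<gamma> t + s *\<^sub>R w')" for t w w'
  proof
    assume "arrives \<gamma> t w \<and> departs \<gamma> t w'"
    then obtain e e' where "e > 0" "\<forall>s\<in>{0..e}. \<gamma> (t - s) = \<gamma> t - s *\<^sub>R w"
      "e' > 0" "\<forall>s\<in>{0..e'}. \<gamma> (t + s) = \<gamma> t + s *\<^sub>R w'"
      unfolding arrives_def departs_def by blast
    then show "\<exists>\<epsilon>>0. \<forall>s\<in>{0..\<epsilon>}. \<gamma> (t - s) = \<gamma> t - s *\<^sub>R w \<and> \<gamma> (t + s) = \<gamma> t + s *\<^sub>R w'"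
      by (intro exI[of _ "min e e'"]) auto
  qed (auto simp: arrives_def departs_def)
  then show ?thesis
    by (simp add: billiard_orbit_def departs_def arrives_def)
qed

lemma arrives_cong:
  assumes "arrives \<gamma> t w" "d > 0" "\<And>s. s \<in> {0..d} \<Longrightarrow> \<delta> (t' - s) = \<gamma> (t - s)"
  shows "arrives \<delta> t' w"
proof -
  obtain e where "e > 0" "\<forall>s\<in>{0..e}. \<gamma> (t - s) = \<gamma> t - s *\<^sub>R w"
    using assms(1) unfolding arrives_def by blast
  then show ?thesis
    unfolding arrives_def using assms(2) assms(3)[of 0] assms(3)
    by (intro exI[of _ "min e d"]) auto
qed

lemma departs_cong:
  assumes "departs \<gamma> t w" "d > 0" "\<And>s. s \<in> {0..d} \<Longrightarrow> \<delta> (t' + s) = \<gamma> (t + s)"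
  shows "departs \<delta> t' w"
proof -
  obtain e where "e > 0" "\<forall>s\<in>{0..e}. \<gamma> (t + s) = \<gamma> t + s *\<^sub>R w"
    using assms(1) unfolding departs_def by blast
  then show ?thesis
    unfolding departs_def using assms(2) assms(3)[of 0] assms(3)
    by (intro exI[of _ "min e d"]) auto
qed

text \<open>An orbit by itself only guarantees that some arrival velocity exists. Keeping
  \<open>w\<close> and \<open>w'\<close> explicit allows the collision rule to be checked at the
  junction and the gluing to be iterated.\<close>

lemma billiard_orbit_concat:
  assumes 1: "billiard_orbit a b \<theta> T1 \<gamma>1" and 2: "billiard_orbit a b \<theta> T2 \<gamma>2"
    and eq: "\<gamma>1 T1 = \<gamma>2 0"
    and w: "w \<in> directions \<theta>" "arrives \<gamma>1 T1 w" "departs \<gamma>2 0 (collide a b (\<gamma>1 T1) w)"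
    and w': "arrives \<gamma>2 T2 w'"
  defines "\<gamma> \<equiv> \<lambda>t. if t \<le> T1 then \<gamma>1 t else \<gamma>2 (t - T1)"
  shows "billiard_orbit a b \<theta> (T1 + T2) \<gamma>" "\<gamma> 0 = \<gamma>1 0" "\<gamma> (T1 + T2) = \<gamma>2 T2"
    "arrives \<gamma> (T1 + T2) w'"
proof -
  have T: "0 < T1" "0 < T2" using 1 2 by (auto simp: billiard_orbit_iff)
  show ends: "\<gamma> 0 = \<gamma>1 0" "\<gamma> (T1 + T2) = \<gamma>2 T2" using T by (auto simp: \<gamma>_def)
  have arr1: "arrives \<gamma> t v" if "arrives \<gamma>1 t v" "0 < t" "t \<le> T1" for t v
    by (rule arrives_cong[OF that(1), of 1]) (use that in \<open>auto simp: \<gamma>_def\<close>)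
  have arr2: "arrives \<gamma> (T1 + t) v" if "arrives \<gamma>2 t v" "0 < t" for t v
    by (rule arrives_cong[OF that(1), of t]) (use that eq in \<open>auto simp: \<gamma>_def\<close>)
  have dep1: "departs \<gamma> t v" if "departs \<gamma>1 t v" "t < T1" for t v
    by (rule departs_cong[OF that(1), of "T1 - t"]) (use that in \<open>auto simp: \<gamma>_def\<close>)
  have dep2: "departs \<gamma> (T1 + t) v" if "departs \<gamma>2 t v" "0 \<le> t" for t v
  proof (rule departs_cong[OF that(1), of 1])
    show "\<gamma> (T1 + t + s) = \<gamma>2 (t + s)" if "s \<in> {0..1}" for s
      using that \<open>0 \<le> t\<close> eq by (cases "t = 0 \<and> s = 0") (auto simp: \<gamma>_def)
  qed simp
  show "arrives \<gamma> (T1 + T2) w'" using arr2 w' T by blast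
  have "\<gamma> t \<in> table" if "t \<in> {0..T1 + T2}" for t
  proof (cases "t \<le> T1")
    case True
    then have "t \<in> {0..T1}" using that by simp
    then show ?thesis using 1 True by (auto simp: billiard_orbit_iff \<gamma>_def)
  next
    case False
    then have "t - T1 \<in> {0..T2}" using that by simp
    then show ?thesis using 2 False by (auto simp: billiard_orbit_iff \<gamma>_def)
  qed
  moreover have "\<exists>v\<in>directions \<theta>. departs \<gamma> 0 v"
    using 1 T dep1 by (auto simp: billiard_orbit_iff)
  moreover have "\<exists>v\<in>directions \<theta>. arrives \<gamma> t v \<and> departs \<gamma> t (collide a b (\<gamma> t) v)"
    if t: "t \<in> {0<..<T1 + T2}" for t
  proof -
    consider "t < T1" | "t = T1" | "t > T1" by linarith
    then show ?thesis
    proof cases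
      case 1
      then have "t \<in> {0<..<T1}" using t by auto
      then obtain v where "v \<in> directions \<theta>" "arrives \<gamma>1 t v" "departs \<gamma>1 t (collide a b (\<gamma>1 t) v)"
        using \<open>billiard_orbit a b \<theta> T1 \<gamma>1\<close> \<open>t \<in> {0<..<T1}\<close> unfolding billiard_orbit_iff by blast
      moreover have "\<gamma> t = \<gamma>1 t" using 1 by (simp add: \<gamma>_def)
      ultimately show ?thesis using arr1[of t v] dep1[of t] t 1 by (intro bexI[of _ v]) auto
    next
      case 2
      have "\<gamma> T1 = \<gamma>1 T1" by (simp add: \<gamma>_def)
      then show ?thesis using 2 w(1) arr1[OF w(2)] dep2[OF w(3)] T by (intro bexI[of _ w]) auto
    next
      case 3
      then have "t - T1 \<in> {0<..<T2}" using t by auto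
      then obtain v where "v \<in> directions \<theta>" "arrives \<gamma>2 (t - T1) v"
          "departs \<gamma>2 (t - T1) (collide a b (\<gamma>2 (t - T1)) v)"
        using 2 unfolding billiard_orbit_iff by blast
      moreover have "\<gamma> t = \<gamma>2 (t - T1)" using 3 by (simp add: \<gamma>_def)
      ultimately show ?thesis using arr2[of "t - T1" v] dep2[of "t - T1"] 3 by (intro bexI[of _ v]) auto
    qed
  qed
  moreover have "\<exists>v\<in>directions \<theta>. arrives \<gamma> (T1 + T2) v"
    using 2 arr2 T by (auto simp: billiard_orbit_iff)
  ultimately show "billiard_orbit a b \<theta> (T1 + T2) \<gamma>"
    using T by (auto simp: billiard_orbit_iff)
qed

section \<open>Straight lines of the unfolded plane as billiard orbits\<close>

text \<open>Used with nonnegative speeds only: all signs of the velocity are carried by the slopes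
  of \<open>tent\<close>, and \<open>directions\<close> is closed under changes of sign.\<close>

definition folded_line :: "real \<Rightarrow> real \<Rightarrow> real \<Rightarrow> real \<Rightarrow> real \<Rightarrow> real \<times> real" where
  "folded_line u v x y t = (tent (x + t * u), tent (y + t * v))"

lemma arrives_folded_line:
  assumes "0 \<le> u" "0 \<le> v"
  shows "arrives (folded_line u v x y) t (u * slope_in (x + t * u), v * slope_in (y + t * v))"
proof -
  obtain d where d: "d > 0"
    "\<And>s. s \<in> {0..d} \<Longrightarrow> tent ((x + t * u) - s * u) = tent (x + t * u) - s * (u * slope_in (x + t * u))"
    using tent_step_in[OF assms(1)] by metis
  obtain e where e: "e > 0"
    "\<And>s. s \<in> {0..e} \<Longrightarrow> tent ((y + t * v) - s * v) = tent (y + t * v) - s * (v * slope_in (y + t * v))"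
    using tent_step_in[OF assms(2)] by metis
  show ?thesis
    unfolding arrives_def folded_line_def
  proof (intro exI[of _ "min d e"] conjI ballI)
    fix s assume "s \<in> {0..min d e}"
    then show "(tent (x + (t - s) * u), tent (y + (t - s) * v)) = (tent (x + t * u), tent (y + t * v)) -
       s *\<^sub>R (u * slope_in (x + t * u), v * slope_in (y + t * v))"
      using d(2)[of s] e(2)[of s] by (simp add: algebra_simps)
  qed (use d e in simp)
qed

lemma departs_folded_line:
  assumes "0 \<le> u" "0 \<le> v"
  shows "departs (folded_line u v x y) t (u * slope_out (x + t * u), v * slope_out (y + t * v))"
proof -
  obtain d where d: "d > 0"
    "\<And>s. s \<in> {0..d} \<Longrightarrow> tent ((x + t * u) + s * u) = tent (x + t * u) + s * (u * slope_out (x + t * u))"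
    using tent_step_out[OF assms(1)] by metis
  obtain e where e: "e > 0"
    "\<And>s. s \<in> {0..e} \<Longrightarrow> tent ((y + t * v) + s * v) = tent (y + t * v) + s * (v * slope_out (y + t * v))"
    using tent_step_out[OF assms(2)] by metis
  show ?thesis
    unfolding departs_def folded_line_def
  proof (intro exI[of _ "min d e"] conjI ballI)
    fix s assume "s \<in> {0..min d e}"
    then show "(tent (x + (t + s) * u), tent (y + (t + s) * v)) = (tent (x + t * u), tent (y + t * v)) +
       s *\<^sub>R (u * slope_out (x + t * u), v * slope_out (y + t * v))"
      using d(2)[of s] e(2)[of s] by (simp add: algebra_simps)
  qed (use d e in simp)
qed

lemma mem_directions:
  "(\<bar>cos \<theta>\<bar> * slope_in x, \<bar>sin \<theta>\<bar> * slope_in y) \<in> directions \<theta>"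
  "(\<bar>cos \<theta>\<bar> * slope_out x, \<bar>sin \<theta>\<bar> * slope_out y) \<in> directions \<theta>"
  by (auto simp: directions_def slope_in_def slope_out_def abs_if)

text \<open>The hypothesis \<open>off\<close> says that the line of the mirror is met only from the
  left, where the mirror is transparent. What remains are reflections at the sides of the table, and
  these are produced by the folding.\<close>

lemma billiard_orbit_folded_line:
  assumes "0 < T"
    and off: "\<And>t. t \<in> {0<..<T} \<Longrightarrow> tent (x + t * \<bar>cos \<theta>\<bar>) = a \<Longrightarrow> slope_in (x + t * \<bar>cos \<theta>\<bar>) = 1"
  shows "billiard_orbit a b \<theta> T (folded_line \<bar>cos \<theta>\<bar> \<bar>sin \<theta>\<bar> x y)"
proof -
  define u v where "u = \<bar>cos \<theta>\<bar>" and "v = \<bar>sin \<theta>\<bar>"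
  have uv: "0 \<le> u" "0 \<le> v" by (auto simp: u_def v_def)
  note arr = arrives_folded_line[OF uv] and dep = departs_folded_line[OF uv]
  have "collide a b (folded_line u v x y t) (u * slope_in (x + t * u), v * slope_in (y + t * v)) =
      (u * slope_out (x + t * u), v * slope_out (y + t * v))" if "t \<in> {0<..<T}" for t
    using off[of t] that uv
    unfolding slope_out_reflect[OF uv(1)] slope_out_reflect[OF uv(2)]
    by (auto simp: collide_def folded_line_def u_def v_def)
  then have mid: "\<exists>w\<in>directions \<theta>. arrives (folded_line u v x y) t w \<and>
      departs (folded_line u v x y) t (collide a b (folded_line u v x y t) w)" if "t \<in> {0<..<T}" for t
    using arr[of x y t] dep[of x y t] mem_directions(1)[of \<theta>, folded u_def v_def] that by metis
  have start: "\<exists>w\<in>directions \<theta>. departs (folded_line u v x y) 0 w"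
    using dep[of x y 0] mem_directions(2)[of \<theta>, folded u_def v_def] by blast
  have stop: "\<exists>w\<in>directions \<theta>. arrives (folded_line u v x y) T w"
    using arr[of x y T] mem_directions(1)[of \<theta>, folded u_def v_def] by blast
  have "folded_line u v x y ` {0..T} \<subseteq> table"
    by (auto simp: folded_line_def table_def tent_nonneg tent_le_half[simplified])
  then show ?thesis
    unfolding billiard_orbit_iff u_def[symmetric] v_def[symmetric]
    using assms(1) mid start stop by blast
qed

section \<open>Legs between arrivals at the mirror line from the right\<close>

text \<open>For a line moving right, \<open>a\<close> and \<open>1 + a\<close> are copies of the
  mirror line crossed from the left, while \<open>1 - a\<close> and \<open>2 - a\<close> are copies
  crossed from the right. Only at the latter can the mirror act.\<close>

lemma slope_values:
  assumes "0 < a" "a < 1/2"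
  shows "slope_out a = 1" "slope_out (1 - a) = -1" "slope_in (1 - a) = -1" "slope_in (2 - a) = -1"
    "slope_in (1 + a) = 1" "tent a = a" "tent (1 - a) = a" "tent (2 - a) = a"
proof -
  have [simp]: "frac a = a" "frac (1 - a) = 1 - a" "frac (2 - a) = 1 - a" "frac (1 + a) = a"
    using assms by (auto simp: frac_unique_iff)
  show "slope_out a = 1" "slope_out (1 - a) = -1" "slope_in (1 - a) = -1" "slope_in (2 - a) = -1"
    "slope_in (1 + a) = 1" "tent a = a" "tent (1 - a) = a" "tent (2 - a) = a"
    using assms by (auto simp: slope_out_def slope_in_def tent_frac)
qed

lemma tent_eq_right_of_mirror:
  assumes "0 < a" "a < 1/2" "tent x = a" "1 - a < x" "x < 2 - a"
  shows "x = 1 + a"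
proof -
  consider "x \<le> 1" | "1 \<le> x" "x \<le> 3/2" | "3/2 \<le> x" by linarith
  then show ?thesis
    using assms tent_left[of 1 x] tent_right[of 1 x] tent_left[of 2 x] by cases auto
qed

lemma tent_neq_between_mirrors:
  assumes "0 < a" "a < 1/2" "a < x" "x < 1 - a"
  shows "tent x \<noteq> a"
proof -
  consider "x \<le> 1/2" | "1/2 \<le> x" by linarith
  then show ?thesis
    using assms tent_right[of 0 x] tent_left[of 1 x] by cases auto
qed

text \<open>A leg of the orbit between two consecutive arrivals at the line of the mirror from the right;
  \<open>J\<close> tells whether the leg starts to the right, i.e. with a reflection.\<close>

lemma billiard_leg:
  fixes z :: real and J :: bool
  assumes a: "0 < a" "a < 1/2" and c: "cos \<theta> \<noteq> 0"
  defines "u \<equiv> \<bar>cos \<theta>\<bar>" and "v \<equiv> \<bar>sin \<theta>\<bar>"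
  defines "z' \<equiv> z + (if J then 1 - 2 * a else 1) * \<bar>tan \<theta>\<bar>"
  obtains T \<gamma> where "billiard_orbit a b \<theta> T \<gamma>" "\<gamma> 0 = (a, tent z)" "\<gamma> T = (a, tent z')"
    "arrives \<gamma> T (- u, v * slope_in z')" "departs \<gamma> 0 (if J then u else - u, v * slope_out z)"
proof -
  \<comment> \<open>A reflected leg runs from \<open>a\<close> to \<open>1 - a\<close>, touching
    only the side at 1/2. A leg passing above the mirror runs from \<open>1 - a\<close> to
    \<open>2 - a\<close>: it touches the left side at 1, recrosses the mirror line from the left at
    \<open>1 + a\<close>, and turns at 3/2.\<close>
  define x where "x = (if J then a else 1 - a)"
  define T where "T = (if J then 1 - 2 * a else 1) / u"
  have u: "u > 0" "0 \<le> v" using c by (auto simp: u_def v_def)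
  have T: "0 < T" using a u by (auto simp: T_def)
  have Tu: "T * u = (if J then 1 - 2 * a else 1)" using u by (simp add: T_def)
  have "\<bar>tan \<theta>\<bar> = v / u" by (simp add: tan_def u_def v_def)
  then have z': "z + T * v = z'" by (simp add: z'_def T_def)
  have xT: "x + T * u = (if J then 1 - a else 2 - a)" using Tu by (simp add: x_def)
  have orbit: "billiard_orbit a b \<theta> T (folded_line u v x z)"
    unfolding u_def v_def
  proof (rule billiard_orbit_folded_line[OF T], fold u_def v_def)
    fix t assume t: "t \<in> {0<..<T}" and eq: "tent (x + t * u) = a"
    have "0 < t * u" "t * u < T * u" using t u by auto
    then have lt: "x < x + t * u" "x + t * u < x + T * u" by auto
    have "\<not> J"
      using tent_neq_between_mirrors[OF a, of "x + t * u"] lt xT eq by (auto simp: x_def)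
    then have "x + t * u = 1 + a"
      using tent_eq_right_of_mirror[OF a eq] lt xT by (auto simp: x_def)
    then show "slope_in (x + t * u) = 1" using slope_values[OF a] by simp
  qed
  have "arrives (folded_line u v x z) T (u * slope_in (x + T * u), v * slope_in (z + T * v))"
    using arrives_folded_line u by simp
  moreover have "u * slope_in (x + T * u) = - u" using slope_values[OF a] xT by simp
  moreover have "departs (folded_line u v x z) 0 (u * slope_out x, v * slope_out z)"
    using departs_folded_line[of u v x z 0] u by simp
  moreover have "u * slope_out x = (if J then u else - u)"
    using slope_values[OF a] by (simp add: x_def)
  moreover have "folded_line u v x z 0 = (a, tent z)"
    using slope_values[OF a] by (simp add: folded_line_def x_def)
  moreover have "folded_line u v x z T = (a, tent z')"
    unfolding folded_line_def z' xT using slope_values[OF a] by simp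
  ultimately show thesis
    using that[of T "folded_line u v x z"] orbit z' by simp
qed

text \<open>\<open>Z\<close> lists the unfolded heights at the successive arrivals.
  \<open>J 0\<close> is unconstrained because no collision rule applies at the start of an orbit, so
  from an end point of the mirror either side may be chosen for departure.\<close>

lemma billiard_chain:
  assumes a: "0 < a" "a < 1/2" and c: "cos \<theta> \<noteq> 0"
    and Z: "\<And>n. Z (Suc n) = Z n + (if J n then 1 - 2 * a else 1) * \<bar>tan \<theta>\<bar>"
    and J: "\<And>i. 0 < i \<Longrightarrow> i \<le> n \<Longrightarrow> J i \<longleftrightarrow> tent (Z i) \<le> b"
  shows "\<exists>T \<gamma>. billiard_orbit a b \<theta> T \<gamma> \<and> \<gamma> 0 = (a, tent (Z 0)) \<and> \<gamma> T = (a, tent (Z (Suc n))) \<and>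
    arrives \<gamma> T (- \<bar>cos \<theta>\<bar>, \<bar>sin \<theta>\<bar> * slope_in (Z (Suc n)))"
  using J
proof (induction n)
  case 0
  show ?case using billiard_leg[OF a c, of b "Z 0" "J 0"] Z[of 0] by metis
next
  case (Suc n)
  define u v where "u = \<bar>cos \<theta>\<bar>" and "v = \<bar>sin \<theta>\<bar>"
  have u: "u > 0" "0 \<le> v" using c by (auto simp: u_def v_def)
  define z where "z = Z (Suc n)"
  obtain T1 \<gamma>1 where 1: "billiard_orbit a b \<theta> T1 \<gamma>1" "\<gamma>1 0 = (a, tent (Z 0))" "\<gamma>1 T1 = (a, tent z)"
    "arrives \<gamma>1 T1 (- u, v * slope_in z)"
    using Suc by (auto simp: u_def v_def z_def)
  obtain T2 \<gamma>2 where 2: "billiard_orbit a b \<theta> T2 \<gamma>2" "\<gamma>2 0 = (a, tent z)"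
    "\<gamma>2 T2 = (a, tent (Z (Suc (Suc n))))" "arrives \<gamma>2 T2 (- u, v * slope_in (Z (Suc (Suc n))))"
    "departs \<gamma>2 0 (if J (Suc n) then u else - u, v * slope_out z)"
    using billiard_leg[OF a c, of b z "J (Suc n)"] Z[of "Suc n"] unfolding u_def v_def z_def by metis
  have "J (Suc n) \<longleftrightarrow> tent z \<le> b" using Suc.prems by (simp add: z_def)
  then have col: "collide a b (\<gamma>1 T1) (- u, v * slope_in z) = (if J (Suc n) then u else - u, v * slope_out z)"
    using a u unfolding slope_out_reflect[OF u(2)] by (auto simp: collide_def 1 tent_nonneg)
  \<comment> \<open>\<open>1 - a\<close> serves as a coordinate with incoming slope -1, which
    exhibits the velocity with horizontal part \<open>- u\<close> as a member of
    \<open>directions\<close>.\<close>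
  have "slope_in (1 - a) = -1" using slope_values[OF a] by simp
  then have dir: "(- u, v * slope_in z) \<in> directions \<theta>"
    using mem_directions(1)[of \<theta> "1 - a" z] by (simp add: u_def v_def)
  have eq: "\<gamma>1 T1 = \<gamma>2 0" using 1 2 by simp
  have dep: "departs \<gamma>2 0 (collide a b (\<gamma>1 T1) (- u, v * slope_in z))" using 2 col by simp
  note concat = billiard_orbit_concat[OF 1(1) 2(1) eq dir 1(4) dep 2(4)]
  define \<delta> where "\<delta> = (\<lambda>t. if t \<le> T1 then \<gamma>1 t else \<gamma>2 (t - T1))"
  have "billiard_orbit a b \<theta> (T1 + T2) \<delta>" "\<delta> 0 = (a, tent (Z 0))"
    "\<delta> (T1 + T2) = (a, tent (Z (Suc (Suc n))))" "arrives \<delta> (T1 + T2) (- u, v * slope_in (Z (Suc (Suc n))))"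
    using concat 1(2) 2(3) by (auto simp: \<delta>_def)
  then show ?case
    unfolding u_def v_def by blast
qed

text \<open>For rational \<open>tan \<theta>\<close> the arrivals of some orbit at the mirror line are periodic modulo 1. Moving
  this closed orbit upwards by the least \<open>s\<close> for which it meets an end point of the mirror does not change its
  itinerary, so it then runs from end point to end point.\<close>

lemma exceptional_if_tan_rational:
  assumes a: "0 < a" "a < 1/2" "a \<in> \<rat>" and b: "0 < b" "b < 1/2" and tan: "tan \<theta> \<in> \<rat>"
  shows "exceptional a b \<theta>"
proof (cases "cos \<theta> = 0")
  case c: False
  define \<tau> where "\<tau> = \<bar>tan \<theta>\<bar>"
  \<comment> \<open>The vertical advance until the next arrival from the right, given arrival at
    height \<open>z\<close>: the two horizontal lengths of a leg, times the slope.\<close>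
  define step where "step z = (if tent z \<le> b then 1 - 2 * a else 1) * \<tau>" for z
  define z where "z n = ((\<lambda>z. z + step z) ^^ n) 0" for n
  have z_Suc: "z (Suc n) = z n + step (z n)" for n by (simp add: z_def)
  have rat: "\<tau> \<in> \<rat>" "(1 - 2 * a) * \<tau> \<in> \<rat>"
    using tan a(3) by (auto simp: \<tau>_def)
  obtain m1 n1 :: int where 1: "n1 > 0" "\<tau> = of_int m1 / of_int n1"
    using rat(1) by (meson Rats_cases')
  obtain m2 n2 :: int where 2: "n2 > 0" "(1 - 2 * a) * \<tau> = of_int m2 / of_int n2"
    using rat(2) by (meson Rats_cases')
  \<comment> \<open>A common denominator of both possible advances, so that all heights
    \<open>z n\<close> are multiples of 1/N.\<close>
  define N where "N = n1 * n2"
  have N: "N > 0" using 1 2 by (simp add: N_def)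
  have "of_int N * \<tau> = of_int (m1 * n2)" using 1 2(1) by (simp add: N_def field_simps)
  moreover have "of_int N * ((1 - 2 * a) * \<tau>) = of_int (m2 * n1)" using 2 1(1) by (simp add: N_def field_simps)
  ultimately have step_int: "of_int N * step x \<in> \<int>" for x
    unfolding step_def by (metis Ints_of_int mult_1)
  have "\<exists>k::int. of_int N * z n = of_int k" for n
  proof (induction n)
    case (Suc n)
    then show ?case
      using step_int[of "z n"] unfolding z_Suc distrib_left by (metis Ints_cases of_int_add)
  qed (simp add: z_def exI[of _ 0])
  then obtain k where k: "\<And>n. of_int N * z n = real_of_int (k n)" by metis
  \<comment> \<open>Pigeonhole: modulo 1 there are at most \<open>N\<close> heights, so two arrivals
    agree.\<close>
  have "\<not> inj (\<lambda>n. k n mod N)"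
  proof
    assume "inj (\<lambda>n. k n mod N)"
    moreover have "range (\<lambda>n. k n mod N) \<subseteq> {0..<N}" using N by auto
    ultimately show False
      using finite_subset[OF _ finite_atLeastLessThan_int] finite_imageD infinite_UNIV_nat by blast
  qed
  then obtain i j where ij: "i < j" "k i mod N = k j mod N"
    unfolding inj_def by (metis linorder_less_linear)
  then obtain d where d: "k j = k i + N * d"
    by (metis mod_eqE mult.commute)
  have "of_int N * z j = of_int N * (z i + of_int d)"
    unfolding distrib_left k d by simp
  then have zj: "z j = z i + of_int d" using N by simp
  define P where "P = j - i"
  have P: "P > 0" "j = i + P" using ij by (auto simp: P_def)
  have step_per: "step (x + of_int d) = step x" for x by (simp add: step_def)
  have per: "z (i + P + n) = z (i + n) + of_int d" for n
    by (induction n) (use zj P in \<open>simp_all add: z_Suc step_per\<close>)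
  \<comment> \<open>The height sequence is only known to be periodic modulo 1 from index
    \<open>i\<close> on; dropping the initial segment leaves the closed orbit.\<close>
  define y where "y n = z (i + n)" for n
  have y_Suc: "y (Suc n) = y n + step (y n)" for n by (simp add: y_def z_Suc)
  have y_per: "y (n + P) = y n + of_int d" for n
    using per[of n] by (simp add: y_def ac_simps)
  \<comment> \<open>Sliding an arrival across height 0 keeps it on the mirror, so the itinerary can
    change only when some arrival reaches height \<open>b\<close>. \<open>E\<close> collects the
    upward shifts at which this happens somewhere on the cycle.\<close>
  define E where "E = (\<Union>n<P. {s. 0 \<le> s \<and> tent (y n + s) = b})"
  have "closed {s. 0 \<le> s \<and> tent (y n + s) = b}" for n
    unfolding Collect_conj_eq
    by (intro closed_Int closed_Collect_le closed_Collect_eq continuous_intros)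
  then have "closed E" unfolding E_def by (intro closed_UN) auto
  \<comment> \<open>This shift moves \<open>y 0\<close> up to an integer translate of
    \<open>b\<close>; the ceiling makes it nonnegative.\<close>
  have "b - y 0 + of_int \<lceil>y 0 - b\<rceil> \<in> {s. 0 \<le> s \<and> tent (y 0 + s) = b}"
  proof -
    have "y 0 + (b - y 0 + of_int \<lceil>y 0 - b\<rceil>) = b + of_int \<lceil>y 0 - b\<rceil>" by simp
    moreover have "tent b = b" using tent_right[of 0 b] b by simp
    ultimately show ?thesis using le_of_int_ceiling[of "y 0 - b"] by (simp del: add_diff_eq) linarith
  qed
  then have "E \<noteq> {}" using P unfolding E_def by blast
  have "bdd_below E" by (rule bdd_belowI[of _ 0]) (auto simp: E_def)
  define s where "s = Inf E"
  have "s \<in> E" unfolding s_def by (rule closed_contains_Inf) fact+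
  then obtain n0 where n0: "n0 < P" "tent (y n0 + s) = b" and "0 \<le> s" by (auto simp: E_def)
  \<comment> \<open>\<open>E\<close> ranges over one period only, which makes it a finite union of
    closed sets; periodicity modulo 1 extends minimality to all indices.\<close>
  have least: "tent (y n + r) \<noteq> b" if "0 \<le> r" "r < s" for n r
  proof
    assume eq: "tent (y n + r) = b"
    have "tent (y (n mod P + m * P) + r) = tent (y (n mod P) + r)" for m
    proof (induction m)
      case (Suc m)
      have "y (n mod P + Suc m * P) + r = y (n mod P + m * P) + r + of_int d"
        using y_per[of "n mod P + m * P"] by (simp add: ac_simps)
      then show ?case by (simp only: tent_add_int Suc)
    qed simp
    from this[of "n div P"] eq have "tent (y (n mod P) + r) = b" by simp
    then have "r \<in> E" using P that by (auto simp: E_def)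
    then show False using that cInf_lower[OF _ \<open>bdd_below E\<close>] unfolding s_def by fastforce
  qed
  \<comment> \<open>If the shift by \<open>s\<close> changed the side of \<open>b\<close>, the
    intermediate value theorem would give a shift at most \<open>s\<close> with height exactly
    \<open>b\<close>. It is not \<open>s\<close> by assumption and not smaller by
    minimality.\<close>
  have itinerary: "tent (y n) \<le> b \<longleftrightarrow> tent (y n + s) \<le> b" if "tent (y n + s) \<noteq> b" for n
  proof (rule ccontr)
    assume neq: "\<not> ?thesis"
    have "continuous_on {0..s} (\<lambda>r. tent (y n + r))" by (intro continuous_intros)
    then have "\<exists>r\<ge>0. r \<le> s \<and> tent (y n + r) = b"
      using neq \<open>0 \<le> s\<close> IVT'[of "\<lambda>r. tent (y n + r)" 0 b s] IVT2'[of "\<lambda>r. tent (y n + r)" s b 0]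
      by (auto simp: not_le less_imp_le)
    then show False using least that by (metis less_eq_real_def)
  qed
  have "tent (y (n0 + P) + s) = b"
  proof -
    have "y (n0 + P) + s = y n0 + s + of_int d" by (simp add: y_per)
    then show ?thesis by (simp only: tent_add_int n0)
  qed
  then have ex: "\<exists>n. tent (y (n0 + Suc n) + s) = b" using P by (intro exI[of _ "P - 1"]) simp
  \<comment> \<open>The first later arrival at height \<open>b\<close>: all arrivals strictly in
    between avoid \<open>b\<close>, so there the shifted and unshifted itineraries agree.\<close>
  define n1 where "n1 = (LEAST n. tent (y (n0 + Suc n) + s) = b)"
  have n1: "tent (y (n0 + Suc n1) + s) = b" unfolding n1_def using ex by (rule LeastI_ex)
  define Z where "Z n = y (n0 + n) + s" for n
  \<comment> \<open>The itinerary is read off the unshifted heights, for which the recursion is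
    known. At index 0 the shifted height is exactly \<open>b\<close> and the choice of departure is
    free.\<close>
  define J where "J n \<longleftrightarrow> tent (y (n0 + n)) \<le> b" for n
  have J: "J n \<longleftrightarrow> tent (Z n) \<le> b" if "0 < n" "n \<le> n1" for n
  proof -
    obtain l where l: "n = Suc l" using \<open>0 < n\<close> by (cases n) auto
    then have "l < n1" using that by simp
    then have "tent (y (n0 + Suc l) + s) \<noteq> b" unfolding n1_def by (rule not_less_Least)
    then show ?thesis using itinerary l by (simp add: J_def Z_def)
  qed
  have Z: "Z (Suc n) = Z n + (if J n then 1 - 2 * a else 1) * \<bar>tan \<theta>\<bar>" for n
    by (simp add: Z_def J_def y_Suc step_def \<tau>_def)
  obtain T \<gamma> where "billiard_orbit a b \<theta> T \<gamma>" "\<gamma> 0 = (a, tent (Z 0))" "\<gamma> T = (a, tent (Z (Suc n1)))"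
    using billiard_chain[OF a(1,2) c, of Z J n1 b, OF Z J] by blast
  moreover have "tent (Z 0) = b" "tent (Z (Suc n1)) = b" using n0 n1 by (auto simp: Z_def)
  ultimately have "billiard_orbit a b \<theta> T \<gamma> \<and> \<gamma> 0 \<in> mirror_endpoints a b \<and> \<gamma> T \<in> mirror_endpoints a b"
    by (simp add: mirror_endpoints_def)
  then show ?thesis unfolding exceptional_def by blast
qed (simp add: exceptional_def)

section \<open>The circle\<close>

lemma to_circle_eq_iff: "to_circle x = to_circle y \<longleftrightarrow> x - y \<in> \<int>"
  by (rule circle.abs_eq_iff)

lemma to_circle_add: "to_circle (x + y) = to_circle x + to_circle y"
  by (simp add: plus_circle.abs_eq)

lemma to_circle_add_int [simp]: "to_circle (x + of_int m) = to_circle x"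
  by (simp add: to_circle_eq_iff)

lemma to_circle_rep_circle: "to_circle (rep_circle y) = y"
  by (rule Quotient_abs_rep[OF Quotient_circle])

lemma continuous_on_to_circle: "continuous_on UNIV to_circle"
  by (auto simp: continuous_on_open_vimage open_circle_def)

lemma continuous_on_circle_translate: "continuous_on UNIV (\<lambda>y :: circle. y + c)"
proof -
  obtain t where t: "c = to_circle t" using to_circle_rep_circle by metis
  have "open ((\<lambda>y. y + c) -` U)" if "open U" for U :: "circle set"
  proof -
    have "to_circle -` ((\<lambda>y. y + c) -` U) = (\<lambda>x. x + t) -` (to_circle -` U)"
      by (auto simp: t to_circle_add)
    moreover have "open ((\<lambda>x. x + t) -` (to_circle -` U))"
      by (rule open_vimage) (use that in \<open>auto simp: open_circle_def intro!: continuous_intros\<close>)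
    ultimately show ?thesis by (simp add: open_circle_def)
  qed
  then show ?thesis by (auto simp: continuous_on_open_vimage)
qed

definition unit_rep :: "circle \<Rightarrow> real" where
  "unit_rep y = frac (rep_circle y)"

lemma unit_rep_bounds: "0 \<le> unit_rep y" "unit_rep y < 1"
  by (auto simp: unit_rep_def frac_lt_1)

lemma to_circle_frac: "to_circle (frac x) = to_circle x"
  by (simp add: to_circle_eq_iff frac_def)

lemma to_circle_unit_rep: "to_circle (unit_rep y) = y"
  by (simp add: unit_rep_def to_circle_frac to_circle_rep_circle)

lemma unit_rep_to_circle: "unit_rep (to_circle x) = frac x"
proof -
  have "to_circle (rep_circle (to_circle x)) = to_circle x" by (rule to_circle_rep_circle)
  then obtain m where "rep_circle (to_circle x) = x + of_int m"
    unfolding to_circle_eq_iff by (metis Ints_cases add_diff_cancel_left' diff_add_cancel add.commute)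
  then show ?thesis by (simp add: unit_rep_def)
qed

text \<open>The section \<open>unit_rep\<close> is discontinuous only at the class of 0. For 0 < a
  \<le> 1 the sublevel set is an open arc together with this closed point, hence Borel though in
  general not open.\<close>

lemma unit_rep_measurable: "unit_rep \<in> borel_measurable borel"
proof (rule borel_measurable_iff_less[THEN iffD2], intro allI)
  fix a :: real
  consider "a \<le> 0" | "a > 1" | "0 < a" "a \<le> 1" by linarith
  then show "{w \<in> space borel. unit_rep w < a} \<in> sets borel"
  proof cases
    case 1
    then have "{w. unit_rep w < a} = {}" using unit_rep_bounds(1) by (force simp: not_less intro: order_trans)
    then show ?thesis by simp
  next
    case 2
    then have "{w. unit_rep w < a} = UNIV" using unit_rep_bounds(2) by (force intro: less_trans)
    then show ?thesis by simp
  next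
    case 3
    have "{x. 0 < frac x \<and> frac x < a} = (\<Union>m::int. {of_int m<..<of_int m + a})"
    proof (intro set_eqI iffI)
      fix x assume "x \<in> {x. 0 < frac x \<and> frac x < a}"
      then show "x \<in> (\<Union>m::int. {of_int m<..<of_int m + a})"
        by (intro UN_I[of "\<lfloor>x\<rfloor>"]) (auto simp: frac_def simp del: frac_gt_0_iff)
    next
      fix x assume "x \<in> (\<Union>m::int. {of_int m<..<of_int m + a})"
      then obtain m :: int where m: "of_int m < x" "x < of_int m + a" by auto
      then have "frac x = x - of_int m" using 3 by (simp add: frac_unique_iff)
      then show "x \<in> {x. 0 < frac x \<and> frac x < a}" using m by (simp del: frac_gt_0_iff)
    qed
    then have "open {x. 0 < frac x \<and> frac x < a}" by (simp only:) (intro open_UN ballI open_greaterThanLessThan)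
    then have "open {y. 0 < unit_rep y \<and> unit_rep y < a}"
      by (simp add: open_circle_def vimage_def unit_rep_to_circle)
    moreover have "closed {y. unit_rep y = 0}"
    proof -
      have "to_circle -` (- {y. unit_rep y = 0}) = - \<int>"
        by (auto simp: unit_rep_to_circle)
      then show ?thesis
        using closed_Ints by (simp add: closed_def open_circle_def)
    qed
    ultimately have "{y. 0 < unit_rep y \<and> unit_rep y < a} \<union> {y. unit_rep y = 0} \<in> sets borel"
      by (intro sets.Un borel_open borel_closed)
    also have "{y. 0 < unit_rep y \<and> unit_rep y < a} \<union> {y. unit_rep y = 0} = {y. unit_rep y < a}"
      using unit_rep_bounds(1) 3 by (auto simp: less_le)
    finally show ?thesis by simp
  qed
qed

lemma circle_orbit_dense:
  assumes "\<alpha> \<notin> \<rat>" "open U" "y \<in> U"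
  shows "\<exists>n\<ge>N. z + to_circle (real n * \<alpha>) \<in> U"
proof -
  obtain x t where x: "y = to_circle x" and t: "z = to_circle t" using to_circle_rep_circle by metis
  have "open (to_circle -` U)" "x \<in> to_circle -` U" using assms x by (auto simp: open_circle_def)
  then obtain e where e: "e > 0" "ball x e \<subseteq> to_circle -` U" by (meson openE)
  \<comment> \<open>The target is shifted back by \<open>N\<close> rotation steps, so that the
    resulting time \<open>N + k\<close> is as late as required.\<close>
  obtain h k where hk: "k > 0" "\<bar>of_int k * \<alpha> - of_int h - (x - t - real N * \<alpha>)\<bar> < e"
    using sequence_of_fractional_parts_is_dense[OF assms(1) e(1)] by blast
  define n where "n = N + nat k"
  have n: "real n = real N + of_int k" using hk(1) by (simp add: n_def)
  have "t + real n * \<alpha> + of_int (- h) \<in> ball x e"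
    using hk(2) by (simp add: n dist_real_def algebra_simps abs_minus_commute)
  then have "to_circle (t + real n * \<alpha> + of_int (- h)) \<in> U" using e by blast
  then have "z + to_circle (real n * \<alpha>) \<in> U" unfolding to_circle_add_int by (simp only: to_circle_add t)
  moreover have "N \<le> n" by (simp add: n_def)
  ultimately show ?thesis by blast
qed

section \<open>Unique ergodicity of irrational rotations\<close>

text \<open>The function \<open>C t = \<integral> \<lfloor>t - r\<rfloor> d\<nu>\<close> with \<open>r = unit_rep\<close> is monotone, and invariance of \<open>\<nu>\<close> makes it
  equivariant under the dense group \<open>\<int> + \<alpha>\<int>\<close>; hence \<open>C t = C 0 + t\<close>. On \<open>[0, 1)\<close>, \<open>1 + C\<close> is the
  distribution function of \<open>r\<close>.\<close>

lemma rotation_invariant_distribution: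
  assumes "prob_space \<nu>" and sets: "sets \<nu> = sets borel" and \<alpha>: "\<alpha> \<notin> \<rat>"
    and inv: "distr \<nu> borel (\<lambda>y. y + to_circle \<alpha>) = \<nu>"
    and t: "0 \<le> t" "t < 1"
  shows "measure \<nu> {y. unit_rep y \<le> t} = t"
proof -
  interpret prob_space \<nu> by fact
  have meas_eq: "borel_measurable \<nu> = (borel_measurable borel :: (circle \<Rightarrow> real) set)"
    by (rule measurable_cong_sets) (auto simp: sets)
  have [measurable]: "unit_rep \<in> borel_measurable \<nu>"
    unfolding meas_eq by (rule unit_rep_measurable)
  have sp [simp]: "space \<nu> = UNIV" using sets_eq_imp_space_eq[OF sets] by simp
  define C where "C t = (\<integral>y. real_of_int \<lfloor>t - unit_rep y\<rfloor> \<partial>\<nu>)" for t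
  have int: "integrable \<nu> (\<lambda>y. real_of_int \<lfloor>t - unit_rep y\<rfloor>)" for t
  proof (rule integrable_const_bound[of _ "\<bar>t\<bar> + 2"])
    show "AE y in \<nu>. norm (real_of_int \<lfloor>t - unit_rep y\<rfloor>) \<le> \<bar>t\<bar> + 2"
    proof (rule AE_I2)
      fix y
      show "norm (real_of_int \<lfloor>t - unit_rep y\<rfloor>) \<le> \<bar>t\<bar> + 2"
        using unit_rep_bounds[of y] floor_correct[of "t - unit_rep y"] by simp linarith
    qed
  qed measurable
  \<comment> \<open>The carry when \<alpha> is added to the representative. Its mean
    \<open>K\<close> is the increment of \<open>C\<close> under translation by \<alpha>.\<close>
  define k where "k y = \<lfloor>unit_rep y + \<alpha>\<rfloor>" for y
  have int_k: "integrable \<nu> (\<lambda>y. real_of_int (k y))"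
  proof (rule integrable_const_bound[of _ "\<bar>\<alpha>\<bar> + 2"])
    show "AE y in \<nu>. norm (real_of_int (k y)) \<le> \<bar>\<alpha>\<bar> + 2"
    proof (rule AE_I2)
      fix y
      show "norm (real_of_int (k y)) \<le> \<bar>\<alpha>\<bar> + 2"
        unfolding k_def using unit_rep_bounds[of y] floor_correct[of "unit_rep y + \<alpha>"] by simp linarith
    qed
    show "(\<lambda>y. real_of_int (k y)) \<in> borel_measurable \<nu>" unfolding k_def by measurable
  qed
  define K where "K = (\<integral>y. real_of_int (k y) \<partial>\<nu>)"
  have rot: "unit_rep (y + to_circle \<alpha>) = unit_rep y + \<alpha> - of_int (k y)" for y
    using unit_rep_to_circle[of "unit_rep y + \<alpha>"] by (simp add: to_circle_add to_circle_unit_rep k_def frac_def)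
  have C_\<alpha>: "C (t + \<alpha>) = C t + K" for t
  proof -
    have "C (t + \<alpha>) = (\<integral>y. real_of_int \<lfloor>t + \<alpha> - unit_rep y\<rfloor> \<partial>distr \<nu> borel (\<lambda>y. y + to_circle \<alpha>))"
      by (simp only: C_def inv)
    also have "\<dots> = (\<integral>y. real_of_int \<lfloor>t + \<alpha> - unit_rep (y + to_circle \<alpha>)\<rfloor> \<partial>\<nu>)"
    proof (rule integral_distr)
      show "(\<lambda>y. y + to_circle \<alpha>) \<in> \<nu> \<rightarrow>\<^sub>M borel"
        unfolding measurable_cong_sets[OF sets refl]
        by (rule borel_measurable_continuous_onI) (rule continuous_on_circle_translate)
      show "(\<lambda>y. real_of_int \<lfloor>t + \<alpha> - unit_rep y\<rfloor>) \<in> borel_measurable borel"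
        using unit_rep_measurable by measurable
    qed
    also have "\<dots> = (\<integral>y. real_of_int \<lfloor>t - unit_rep y\<rfloor> + real_of_int (k y) \<partial>\<nu>)"
    proof -
      have "t + \<alpha> - (unit_rep y + \<alpha> - of_int (k y)) = t - unit_rep y + of_int (k y)" for y by simp
      then show ?thesis by (simp only: rot floor_add_int[symmetric] of_int_add)
    qed
    also have "\<dots> = C t + K" using int int_k by (simp add: C_def K_def)
    finally show ?thesis .
  qed
  have C_int: "C (t + of_int m) = C t + of_int m" for t m
  proof -
    have "t + of_int m - r = t - r + of_int m" for r by simp
    then have "C (t + of_int m) = (\<integral>y. real_of_int \<lfloor>t - unit_rep y\<rfloor> + real_of_int m \<partial>\<nu>)"
      by (simp only: C_def floor_add_int[symmetric] of_int_add)
    then show ?thesis using int by (simp add: C_def prob_space[unfolded sp])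
  qed
  have C_mono: "C s \<le> C t" if "s \<le> t" for s t
    unfolding C_def
  proof (rule integral_mono[OF int int])
    show "real_of_int \<lfloor>s - unit_rep y\<rfloor> \<le> real_of_int \<lfloor>t - unit_rep y\<rfloor>" for y
      using that floor_mono[of "s - unit_rep y" "t - unit_rep y"] by simp
  qed
  have C_n: "C (real n * \<alpha>) = C 0 + real n * K" for n
  proof (induction n)
    case (Suc n)
    then show ?case using C_\<alpha>[of "real n * \<alpha>"] by (simp add: algebra_simps)
  qed simp
  \<comment> \<open>Monotonicity squeezes \<open>n K\<close> between the same consecutive integers
    as \<open>n \<alpha>\<close>. A bound independent of \<open>n\<close> then forces
    \<open>K = \<alpha>\<close>.\<close>
  have "\<bar>real n * (K - \<alpha>)\<bar> \<le> 1" for n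
  proof -
    define m where "m = \<lfloor>real n * \<alpha>\<rfloor>"
    have m: "of_int m \<le> real n * \<alpha>" "real n * \<alpha> \<le> of_int (m + 1)"
      unfolding m_def by linarith+
    have "C (of_int m) \<le> C (real n * \<alpha>)" "C (real n * \<alpha>) \<le> C (of_int (m + 1))"
      using m by (auto intro!: C_mono)
    then have "of_int m \<le> real n * K" "real n * K \<le> of_int (m + 1)"
      using C_int[of 0 m] C_int[of 0 "m + 1"] C_n[of n] by auto
    then show ?thesis using m by (simp add: algebra_simps abs_le_iff)
  qed
  then have K: "K = \<alpha>"
  proof -
    assume bd: "\<And>n. \<bar>real n * (K - \<alpha>)\<bar> \<le> 1"
    show ?thesis
    proof (rule ccontr)
      assume "K \<noteq> \<alpha>"
      then obtain n where "1 < real n * \<bar>K - \<alpha>\<bar>"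
        using reals_Archimedean3[of "\<bar>K - \<alpha>\<bar>"] by auto
      then show False using bd[of n] by (simp add: abs_mult)
    qed
  qed
  \<comment> \<open>The identity \<open>C g = C 0 + g\<close> holds on the dense set of integers
    plus positive multiples of \<alpha>; monotonicity of \<open>C\<close> then carries it to every
    real number.\<close>
  have near: "\<exists>g. \<bar>g - x\<bar> < e \<and> C g = C 0 + g" if e: "e > 0" for x e
  proof -
    obtain h l where l: "l > 0" "\<bar>of_int l * \<alpha> - of_int h - x\<bar> < e"
      using sequence_of_fractional_parts_is_dense[OF \<alpha> e] by blast
    have "C (real (nat l) * \<alpha> + of_int (- h)) = C 0 + (real (nat l) * \<alpha> + of_int (- h))"
      by (simp only: C_int C_n K add.assoc)
    then show ?thesis using l by (intro exI[of _ "of_int l * \<alpha> - of_int h"]) simp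
  qed
  have C_eq: "C t = C 0 + t" for t
  proof (rule antisym)
    show "C t \<le> C 0 + t"
    proof (rule field_le_epsilon)
      fix e :: real assume "e > 0"
      then obtain g where g: "\<bar>g - (t + e / 2)\<bar> < e / 2" "C g = C 0 + g" using near[of "e / 2"] by auto
      then have "t \<le> g" "g \<le> t + e" by (auto simp: abs_less_iff field_simps)
      then show "C t \<le> C 0 + t + e" using C_mono[of t g] g by simp
    qed
    show "C 0 + t \<le> C t"
    proof (rule field_le_epsilon)
      fix e :: real assume "e > 0"
      then obtain g where g: "\<bar>g - (t - e / 2)\<bar> < e / 2" "C g = C 0 + g" using near[of "e / 2"] by auto
      then have "g \<le> t" "t \<le> g + e" by (auto simp: abs_less_iff field_simps)
      then show "C 0 + t \<le> C t + e" using C_mono[of g t] g by simp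
    qed
  qed
  have meas: "measure \<nu> {y. unit_rep y \<le> s} = 1 + C 0 + s" if s: "0 \<le> s" "s < 1" for s
  proof -
    have [measurable]: "{y. unit_rep y \<le> s} \<in> sets \<nu>"
      using borel_measurable_le[of unit_rep \<nu> "\<lambda>_. s"] by simp
    have "real_of_int \<lfloor>s - unit_rep y\<rfloor> = indicator {y. unit_rep y \<le> s} y - 1" for y
    proof (cases "unit_rep y \<le> s")
      case True
      then have "\<lfloor>s - unit_rep y\<rfloor> = 0" using unit_rep_bounds[of y] s by (intro floor_unique) auto
      then show ?thesis using True by simp
    next
      case False
      then have "\<lfloor>s - unit_rep y\<rfloor> = -1" using unit_rep_bounds[of y] s by (intro floor_unique) auto
      then show ?thesis using False by simp
    qed
    then have "C s = (\<integral>y. indicator {y. unit_rep y \<le> s} y - 1 \<partial>\<nu>)" by (simp add: C_def)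
    also have "\<dots> = measure \<nu> {y. unit_rep y \<le> s} - 1"
      by (subst Bochner_Integration.integral_diff) (auto simp: prob_space[unfolded sp] emeasure_eq_measure)
    finally show ?thesis using C_eq[of s] by simp
  qed
  have "C 0 = -1"
  proof (rule ccontr)
    assume "C 0 \<noteq> -1"
    moreover have "0 \<le> 1 + C 0" "1 + C 0 \<le> 1"
      using meas[of 0] measure_nonneg[of \<nu> "{y. unit_rep y \<le> 0}"] prob_le_1[of "{y. unit_rep y \<le> 0}"] by auto
    ultimately have "-1 < C 0" "C 0 \<le> 0" by linarith+
    \<comment> \<open>The midpoint of \<open>- C 0\<close> and 1: beyond \<open>- C 0\<close> the
      formula for the distribution function would exceed total mass 1.\<close>
    then have "0 \<le> (1 - C 0) / 2" "(1 - C 0) / 2 < 1" "1 + C 0 + (1 - C 0) / 2 > 1" by (auto simp: field_simps)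
    then show False using meas[of "(1 - C 0) / 2"] prob_le_1[of "{y. unit_rep y \<le> (1 - C 0) / 2}"] by simp
  qed
  then show ?thesis using meas t by simp
qed

text \<open>The law of \<open>unit_rep\<close> is uniform on [0, 1) for both measures, and it
  determines the measure because \<open>to_circle\<close> recovers the point from its
  representative.\<close>

lemma rotation_uniquely_ergodic:
  assumes \<alpha>: "\<alpha> \<notin> \<rat>"
    and 1: "prob_space \<nu>1" "sets \<nu>1 = sets borel" "distr \<nu>1 borel (\<lambda>y. y + to_circle \<alpha>) = \<nu>1"
    and 2: "prob_space \<nu>2" "sets \<nu>2 = sets borel" "distr \<nu>2 borel (\<lambda>y. y + to_circle \<alpha>) = \<nu>2"
  shows "\<nu>1 = \<nu>2"
proof -
  have m: "unit_rep \<in> borel_measurable \<nu>" if "sets \<nu> = sets borel" for \<nu> :: "circle measure"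
    unfolding measurable_cong_sets[OF that refl] by (rule unit_rep_measurable)
  have cdf: "cdf (distr \<nu> borel unit_rep) t = (if t < 0 then 0 else if t < 1 then t else 1)"
    if "prob_space \<nu>" "sets \<nu> = sets borel" "distr \<nu> borel (\<lambda>y. y + to_circle \<alpha>) = \<nu>" for \<nu> t
  proof -
    interpret prob_space \<nu> by fact
    have sp: "space \<nu> = UNIV" using sets_eq_imp_space_eq[OF that(2)] by simp
    have eq: "cdf (distr \<nu> borel unit_rep) t = measure \<nu> {y. unit_rep y \<le> t}"
      by (simp add: cdf_def measure_distr m[OF that(2)] sp vimage_def)
    consider "t < 0" | "0 \<le> t" "t < 1" | "1 \<le> t" by linarith
    then show ?thesis
    proof cases
      case 1
      then have "{y. unit_rep y \<le> t} = {}" using unit_rep_bounds(1) by (auto simp: not_le intro: less_le_trans)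
      then show ?thesis using 1 eq by simp
    next
      case 2
      then show ?thesis using eq rotation_invariant_distribution[OF that(1,2) \<alpha> that(3)] by simp
    next
      case 3
      then have "{y. unit_rep y \<le> t} = space \<nu>" using unit_rep_bounds(2) by (auto simp: sp intro: less_imp_le less_le_trans)
      then show ?thesis using 3 eq by (simp add: prob_space)
    qed
  qed
  have "distr \<nu>1 borel unit_rep = distr \<nu>2 borel unit_rep"
    by (rule cdf_unique)
       (auto simp: cdf[OF 1] cdf[OF 2] prob_space.real_distribution_distr 1 2 m)
  moreover have "emeasure \<nu> A = emeasure (distr \<nu> borel unit_rep) (to_circle -` A)"
    if "sets \<nu> = sets borel" "A \<in> sets borel" for \<nu> and A :: "circle set"
  proof -
    have "to_circle \<in> borel_measurable borel"
      by (rule borel_measurable_continuous_onI) (rule continuous_on_to_circle)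
    then have "to_circle -` A \<in> sets borel" using that(2) measurable_sets[of to_circle borel borel A] by simp
    then have "emeasure (distr \<nu> borel unit_rep) (to_circle -` A) =
        emeasure \<nu> (unit_rep -` (to_circle -` A) \<inter> space \<nu>)"
      by (simp add: emeasure_distr m[OF that(1)])
    also have "unit_rep -` (to_circle -` A) \<inter> space \<nu> = A"
      using sets_eq_imp_space_eq[OF that(1)] by (auto simp: to_circle_unit_rep)
    finally show ?thesis by simp
  qed
  ultimately show ?thesis using 1 2 by (intro measure_eqI) auto
qed

section \<open>Mutual singularity of ergodic measures\<close>

text \<open>A set \<open>E\<close> maximising \<open>\<mu> E - \<nu> E\<close> exists by the Hahn decomposition. Maximisers are closed under preimages,
  countable increasing unions and decreasing intersections, so \<open>limsup T\<^sup>-\<^sup>n E\<close> is a strictly invariant one.\<close>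

lemma ergodic_measures_separated:
  fixes T :: "'a :: topological_space \<Rightarrow> 'a"
  assumes T: "T \<in> borel \<rightarrow>\<^sub>M borel" and "ergodic_measure T \<mu>" "ergodic_measure T \<nu>" "\<mu> \<noteq> \<nu>"
  shows "\<exists>A\<in>sets borel. emeasure \<mu> A = 1 \<and> emeasure \<nu> A = 0"
proof -
  have sets: "sets \<mu> = sets borel" "sets \<nu> = sets borel" and "prob_space \<mu>" "prob_space \<nu>"
    and inv: "\<And>A. A \<in> sets borel \<Longrightarrow> emeasure \<mu> (T -` A) = emeasure \<mu> A"
      "\<And>A. A \<in> sets borel \<Longrightarrow> emeasure \<nu> (T -` A) = emeasure \<nu> A"
    and erg: "\<And>A. A \<in> sets borel \<Longrightarrow> T -` A = A \<Longrightarrow> emeasure \<mu> A = 0 \<or> emeasure \<mu> A = 1"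
      "\<And>A. A \<in> sets borel \<Longrightarrow> T -` A = A \<Longrightarrow> emeasure \<nu> A = 0 \<or> emeasure \<nu> A = 1"
    using assms by (auto simp: ergodic_measure_def invariant_measure_def)
  interpret \<mu>: prob_space \<mu> by fact
  interpret \<nu>: prob_space \<nu> by fact
  note [simp] = sets
  have sp [simp]: "space \<mu> = UNIV" "space \<nu> = UNIV"
    using sets_eq_imp_space_eq[OF sets(1)] sets_eq_imp_space_eq[OF sets(2)] by auto
  define d where "d A = measure \<mu> A - measure \<nu> A" for A
  obtain E where E [simp]: "E \<in> sets borel"
    and E1: "\<And>X. X \<in> sets borel \<Longrightarrow> X \<subseteq> E \<Longrightarrow> emeasure \<nu> X \<le> emeasure \<mu> X"
    and E2: "\<And>X. X \<in> sets borel \<Longrightarrow> X \<inter> E = {} \<Longrightarrow> emeasure \<mu> X \<le> emeasure \<nu> X"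
    using finite_unsigned_Hahn_decomposition[of \<mu> \<nu>] \<mu>.finite_measure_axioms \<nu>.finite_measure_axioms
    by auto
  \<comment> \<open>Modularity: if \<open>A\<close> and \<open>B\<close> both attain the maximum of
    \<open>d\<close>, neither summant on the left can fall below it, so the union attains it
    too.\<close>
  have d_Un: "d (A \<union> B) + d (A \<inter> B) = d A + d B" if "A \<in> sets borel" "B \<in> sets borel" for A B
    using \<mu>.finite_measure_Union'[of A B] \<nu>.finite_measure_Union'[of A B]
      \<mu>.finite_measure_Diff'[of B A] \<nu>.finite_measure_Diff'[of B A] that
    by (simp add: d_def Int_commute)
  have le_dE: "d A \<le> d E" if A: "A \<in> sets borel" for A
  proof -
    have "d (A - E) \<le> 0"
      using E2[of "A - E"] sets.Diff[OF A E] by (auto simp: d_def \<mu>.emeasure_eq_measure \<nu>.emeasure_eq_measure)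
    moreover have "0 \<le> d (E - A)"
      using E1[of "E - A"] sets.Diff[OF E A] by (auto simp: d_def \<mu>.emeasure_eq_measure \<nu>.emeasure_eq_measure)
    moreover have "d A = d (A - E) + d (A \<inter> E)" "d E = d (E - A) + d (A \<inter> E)"
      using \<mu>.finite_measure_Diff'[of A E] \<nu>.finite_measure_Diff'[of A E]
        \<mu>.finite_measure_Diff'[of E A] \<nu>.finite_measure_Diff'[of E A] A
      by (simp_all add: d_def Int_commute)
    ultimately show ?thesis by linarith
  qed
  \<comment> \<open>Both measures have mass 1, so \<open>d\<close> changes sign under complement; a
    nonpositive maximum would make \<open>d\<close> vanish identically.\<close>
  have dE_pos: "d E > 0"
  proof (rule ccontr)
    assume neg: "\<not> d E > 0"
    have "emeasure \<mu> A = emeasure \<nu> A" if A: "A \<in> sets borel" for A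
    proof -
      have "d (- A) = - d A"
        using \<mu>.prob_compl[of A] \<nu>.prob_compl[of A] A by (simp add: d_def Compl_eq_Diff_UNIV)
      then have "d A = 0" using le_dE[of A] le_dE[of "- A"] A neg by auto
      then show ?thesis by (simp add: d_def \<mu>.emeasure_eq_measure \<nu>.emeasure_eq_measure)
    qed
    then have "\<mu> = \<nu>" by (intro measure_eqI) auto
    then show False using assms by simp
  qed
  have d_T: "d (T -` A) = d A" if "A \<in> sets borel" for A
    using inv[OF that] by (simp add: d_def measure_def)
  have T_sets [simp]: "T -` A \<in> sets borel" if "A \<in> sets borel" for A
    using measurable_sets[OF T that] by simp
  have d_Un_max: "d (A \<union> B) = d E"
    if "A \<in> sets borel" "B \<in> sets borel" "d A = d E" "d B = d E" for A B
    using d_Un[of A B] le_dE[of "A \<union> B"] le_dE[of "A \<inter> B"] that by simp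
  define B where "B n = (T ^^ n) -` E" for n
  have T_B: "T -` B n = B (Suc n)" for n
    by (auto simp: B_def funpow_swap1)
  have B: "B n \<in> sets borel \<and> d (B n) = d E" for n
  proof (induction n)
    case (Suc n)
    then show ?case using d_T[of "B n"] by (simp flip: T_B)
  qed (simp add: B_def)
  have limit_max: "d X = d E" if "(\<lambda>n. measure \<mu> (Y n)) \<longlonglongrightarrow> measure \<mu> X" "(\<lambda>n. measure \<nu> (Y n)) \<longlonglongrightarrow> measure \<nu> X"
    "\<And>n. d (Y n) = d E" for X Y
  proof -
    have "(\<lambda>n. d (Y n)) \<longlonglongrightarrow> d X" unfolding d_def using that(1,2) by (rule tendsto_diff)
    then show ?thesis using that(3) by (simp add: LIMSEQ_const_iff)
  qed
  define U where "U N = (\<Union>n. B (N + n))" for N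
  have U: "U N \<in> sets borel \<and> d (U N) = d E" for N
  proof -
    define Y where "Y k = (\<Union>n\<le>k. B (N + n))" for k
    have Ys: "Y k \<in> sets borel" for k unfolding Y_def using B by (intro sets.finite_UN) auto
    have "d (Y k) = d E" for k
    proof (induction k)
      case (Suc k)
      have "Y (Suc k) = Y k \<union> B (N + Suc k)" by (auto simp: Y_def atMost_Suc)
      then show ?case using Suc B Ys d_Un_max by simp
    qed (use B in \<open>simp add: Y_def\<close>)
    moreover have "incseq Y" by (auto simp: incseq_def Y_def intro: order_trans)
    then have "(\<lambda>k. measure \<mu> (Y k)) \<longlonglongrightarrow> measure \<mu> (\<Union>k. Y k)" "(\<lambda>k. measure \<nu> (Y k)) \<longlonglongrightarrow> measure \<nu> (\<Union>k. Y k)"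
      by (intro \<mu>.finite_Lim_measure_incseq \<nu>.finite_Lim_measure_incseq; use Ys in auto)+
    moreover have "(\<Union>k. Y k) = U N" by (auto simp: Y_def U_def)
    ultimately have "d (U N) = d E"
      using limit_max[of Y "U N"] by simp
    moreover have "U N \<in> sets borel" unfolding U_def using B by (intro sets.countable_UN) auto
    ultimately show ?thesis by simp
  qed
  have U_dec: "U (Suc N) \<subseteq> U N" for N
  proof
    fix x assume "x \<in> U (Suc N)"
    then obtain n where "x \<in> B (N + Suc n)" by (auto simp: U_def)
    then show "x \<in> U N" unfolding U_def by blast
  qed
  then have "decseq U" by (rule decseq_SucI)
  \<comment> \<open>Ergodicity is stated for sets with \<open>T\<close>-preimage exactly equal to
    the set. The preimage of a tail union is the next tail union, so the intersection of this
    decreasing sequence has that property.\<close>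
  define L where "L = (\<Inter>N. U N)"
  have L: "L \<in> sets borel" unfolding L_def using U by (intro sets.countable_INT) auto
  have "(\<lambda>k. measure \<mu> (U k)) \<longlonglongrightarrow> measure \<mu> L" "(\<lambda>k. measure \<nu> (U k)) \<longlonglongrightarrow> measure \<nu> L"
    unfolding L_def
    by (intro \<mu>.finite_Lim_measure_decseq \<nu>.finite_Lim_measure_decseq \<open>decseq U\<close>; use U in auto)+
  then have "d L = d E" by (rule limit_max) (use U in blast)
  have "T -` U N = U (Suc N)" for N
    unfolding U_def vimage_UN T_B by simp
  then have "T -` L = (\<Inter>N. U (Suc N))" by (simp add: L_def vimage_INT)
  also have "\<dots> = L" unfolding L_def using U_dec by blast
  finally have "T -` L = L" .
  then have "emeasure \<mu> L = 0 \<or> emeasure \<mu> L = 1" "emeasure \<nu> L = 0 \<or> emeasure \<nu> L = 1"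
    using erg L by auto
  moreover have "measure \<mu> L > measure \<nu> L" using \<open>d L = d E\<close> dE_pos by (simp add: d_def)
  ultimately have "emeasure \<mu> L = 1 \<and> emeasure \<nu> L = 0"
    by (auto simp: measure_def)
  then show ?thesis using L by blast
qed

section \<open>The interval translation map\<close>

lemma to_circle_mem_arc_iff:
  "to_circle x \<in> to_circle ` {-b..b} \<longleftrightarrow> tent x \<le> b"
proof
  assume "to_circle x \<in> to_circle ` {-b..b}"
  then obtain y where y: "-b \<le> y" "y \<le> b" "x - y \<in> \<int>" by (auto simp: to_circle_eq_iff)
  then obtain m where "x = y + of_int m" by (metis Ints_cases diff_add_cancel add.commute)
  then show "tent x \<le> b" using tent_le_dist[of x m] y by simp
next
  assume "tent x \<le> b"
  then have "x - of_int (round x) \<in> {-b..b}" by (auto simp: tent_def abs_le_iff)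
  moreover have "to_circle x = to_circle (x - of_int (round x))" by (simp add: to_circle_eq_iff)
  ultimately show "to_circle x \<in> to_circle ` {-b..b}" by blast
qed

lemma closed_arc:
  "closed (to_circle ` {-b..b})"
proof -
  have "to_circle -` (- (to_circle ` {-b..b})) = {x. b < tent x}"
    using to_circle_mem_arc_iff by (auto simp: not_le)
  moreover have "open {x. b < tent x}" by (intro open_Collect_less continuous_intros)
  ultimately show ?thesis by (simp add: closed_def open_circle_def)
qed

text \<open>The ends of the arc are the points with \<open>tent c = b\<close>. Inside, the set where
  \<open>tent\<close> is below \<open>b\<close> is invariant under integer translations and so has
  open image in the quotient; outside, the complement of the closed arc serves.\<close>

lemma arc_locally_constant:
  assumes "tent c \<noteq> b"
  obtains W where "open W" "to_circle c \<in> W"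
    "\<And>y. y \<in> W \<Longrightarrow> y \<in> to_circle ` {-b..b} \<longleftrightarrow> to_circle c \<in> to_circle ` {-b..b}"
proof (cases "tent c < b")
  case True
  let ?W = "to_circle ` {x. tent x < b}"
  have sat: "to_circle x \<in> ?W \<longleftrightarrow> tent x < b" for x
  proof
    assume "to_circle x \<in> ?W"
    then obtain y where "tent y < b" "x - y \<in> \<int>" by (auto simp: to_circle_eq_iff)
    then obtain m where "x = y + of_int m" by (metis Ints_cases diff_add_cancel add.commute)
    then show "tent x < b" using \<open>tent y < b\<close> by simp
  qed auto
  then have "to_circle -` ?W = {x. tent x < b}" by auto
  moreover have "open {x. tent x < b}" by (intro open_Collect_less continuous_intros)
  ultimately have "open ?W" by (simp add: open_circle_def)
  moreover have "to_circle c \<in> ?W" using True by simp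
  moreover have "y \<in> to_circle ` {-b..b} \<longleftrightarrow> to_circle c \<in> to_circle ` {-b..b}" if "y \<in> ?W" for y
    using that True by (auto simp: to_circle_mem_arc_iff simp del: image_iff)
  ultimately show thesis by (rule that)
next
  case False
  then have "to_circle c \<notin> to_circle ` {-b..b}" using assms to_circle_mem_arc_iff[of c b] by linarith
  then show thesis using that[of "- (to_circle ` {-b..b})"] closed_arc by auto
qed

lemma snd_itm: "snd (itm p q b \<theta> z) = snd z + to_circle (tan \<theta> / real q)"
  by (auto simp: itm_def split: prod.split)

lemma snd_itm_funpow: "snd ((itm p q b \<theta> ^^ n) z) = snd z + to_circle (real n * (tan \<theta> / real q))"
proof (induction n)
  case 0
  have "to_circle 0 = 0" by (simp add: zero_circle.abs_eq)
  then show ?case by simp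
next
  case (Suc n)
  have "real (Suc n) * (tan \<theta> / real q) = real n * (tan \<theta> / real q) + tan \<theta> / real q"
    by (simp only: of_nat_Suc distrib_right mult_1_left add.commute)
  then show ?case by (simp only: funpow.simps comp_def snd_itm Suc to_circle_add add.assoc)
qed

lemma fst_itm_less: "p < q \<Longrightarrow> fst (itm p q b \<theta> z) < q"
  by (auto simp: itm_def split: prod.split)

lemma fst_itm_funpow_less: "p < q \<Longrightarrow> fst z < q \<Longrightarrow> fst ((itm p q b \<theta> ^^ n) z) < q"
  by (cases n) (auto simp: fst_itm_less)

section \<open>Limit sets and continuity points\<close>

lemma mem_closure_iff_open:
  "x \<in> closure S \<longleftrightarrow> (\<forall>U. open U \<longrightarrow> x \<in> U \<longrightarrow> (\<exists>y\<in>S. y \<in> U))"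
proof
  assume "x \<in> closure S"
  then show "\<forall>U. open U \<longrightarrow> x \<in> U \<longrightarrow> (\<exists>y\<in>S. y \<in> U)"
    by (metis Int_iff disjoint_iff open_Int_closure_eq_empty)
next
  assume *: "\<forall>U. open U \<longrightarrow> x \<in> U \<longrightarrow> (\<exists>y\<in>S. y \<in> U)"
  show "x \<in> closure S"
    using *[rule_format, of "- closure S"] closure_subset[of S] by (metis ComplD ComplI closed_closure open_Compl subsetD)
qed

lemma mem_omega_limit_iff:
  "z \<in> omega_limit T x \<longleftrightarrow> (\<forall>N U. open U \<longrightarrow> z \<in> U \<longrightarrow> (\<exists>n\<ge>N. (T ^^ n) x \<in> U))"
  unfolding omega_limit_def mem_closure_iff_open INT_iff by blast

lemma closed_omega_limit: "closed (omega_limit T x)"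
  unfolding omega_limit_def by (intro closed_INT ballI closed_closure)

text \<open>Continuity at the single point \<open>z\<close> is enough to stay in the limit set for
  one step, which makes the lemma applicable to a discontinuous map.\<close>

lemma omega_limit_step:
  assumes z: "z \<in> omega_limit T x"
    and cont: "\<And>V. open V \<Longrightarrow> T z \<in> V \<Longrightarrow> \<exists>U. open U \<and> z \<in> U \<and> T ` U \<subseteq> V"
  shows "T z \<in> omega_limit T x"
  unfolding mem_omega_limit_iff
proof (intro allI impI)
  fix N V assume "open V" "T z \<in> V"
  then obtain U where U: "open U" "z \<in> U" "T ` U \<subseteq> V" using cont by blast
  then obtain n where n: "n \<ge> N" "(T ^^ n) x \<in> U" using z unfolding mem_omega_limit_iff by blast
  then have "(T ^^ Suc n) x \<in> V" using U by auto
  then show "\<exists>n\<ge>N. (T ^^ n) x \<in> V" using n by (metis le_Suc_eq)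
qed

lemma itm_locally_continuous:
  assumes "tent c \<noteq> b" "open V" "itm p q b \<theta> (i, to_circle c) \<in> V"
  shows "\<exists>U. open U \<and> (i, to_circle c) \<in> U \<and> itm p q b \<theta> ` U \<subseteq> V"
proof -
  define S where "S = itm p q b \<theta>"
  define \<tau> where "\<tau> = to_circle (tan \<theta> / real q)"
  define j where "j = fst (S (i, to_circle c))"
  obtain W where W: "open W" "to_circle c \<in> W"
    "\<And>y. y \<in> W \<Longrightarrow> y \<in> to_circle ` {-b..b} \<longleftrightarrow> to_circle c \<in> to_circle ` {-b..b}"
    using arc_locally_constant[OF assms(1)] by metis
  have S: "S (i, y) = (j, y + \<tau>)" if "y \<in> W" for y
    using W(3)[OF that] by (simp add: S_def itm_def j_def \<tau>_def)
  have "continuous_on UNIV (\<lambda>y. (j, y + \<tau>))"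
    by (intro continuous_on_Pair continuous_on_const continuous_on_circle_translate)
  then have "open ((\<lambda>y. (j, y + \<tau>)) -` V)" using assms(2) by (rule open_vimage[rotated])
  then have "open ({i} \<times> (W \<inter> (\<lambda>y. (j, y + \<tau>)) -` V))"
    using W by (intro open_Times open_Int) (auto simp: Topological_Spaces.open_discrete)
  moreover have "(i, to_circle c) \<in> {i} \<times> (W \<inter> (\<lambda>y. (j, y + \<tau>)) -` V)"
    using assms(3) S[OF W(2)] W(2) by (simp add: S_def)
  moreover have "S ` ({i} \<times> (W \<inter> (\<lambda>y. (j, y + \<tau>)) -` V)) \<subseteq> V"
    using S by auto
  ultimately show ?thesis unfolding S_def by blast
qed

section \<open>Counting minimal components\<close>

text \<open>Each \<open>n\<close> excludes only the integer translates of
  \<open>b - n \<alpha>\<close> and \<open>- b - n \<alpha>\<close>; altogether countably many reals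
  are lost.\<close>

lemma generic_point_exists:
  "\<exists>c. \<forall>n. tent (c + real n * \<alpha>) \<noteq> b"
proof -
  define X where "X = (\<Union>n::nat. \<Union>m::int. {b + of_int m - real n * \<alpha>, - b + of_int m - real n * \<alpha>})"
  have "countable X" unfolding X_def by (intro countable_UN countable_insert countable_empty) auto
  then obtain c where c: "c \<notin> X" using uncountable_UNIV_real by (metis UNIV_I countable_subset subsetI)
  have "tent (c + real n * \<alpha>) \<noteq> b" for n
  proof
    assume "tent (c + real n * \<alpha>) = b"
    then have "c = b + of_int (round (c + real n * \<alpha>)) - real n * \<alpha> \<or>
        c = - b + of_int (round (c + real n * \<alpha>)) - real n * \<alpha>"
      by (auto simp: tent_def abs_if split: if_splits)
    then have "c \<in> X" unfolding X_def by blast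
    then show False using c by simp
  qed
  then show ?thesis by blast
qed

lemma minimal_component_orbit_closure:
  assumes pq: "p < q" and irr: "tan \<theta> / real q \<notin> \<rat>"
    and c: "\<And>n. tent (c + real n * (tan \<theta> / real q)) \<noteq> b"
    and M: "minimal_component (sections q) (itm p q b \<theta>) M"
  shows "\<exists>i<q. M = closure (range (\<lambda>n. (itm p q b \<theta> ^^ n) (i, to_circle c)))"
proof -
  define S where "S = itm p q b \<theta>"
  define \<alpha> where "\<alpha> = tan \<theta> / real q"
  obtain x where x: "fst x < q" "M = omega_limit S x"
    and dense: "\<And>z. z \<in> M \<Longrightarrow> M \<subseteq> closure (range (\<lambda>n. (S ^^ n) z))"
    using M by (auto simp: minimal_component_def sections_def S_def)
  \<comment> \<open>Otherwise each of the \<open>q\<close> fibre points has a neighbourhood free of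
    the orbit from some time on. Their slices intersect in an open set \<open>W\<close> around the
    base point, and the rotation enters \<open>W\<close> after the largest of these times, putting
    the orbit into one of the neighbourhoods.\<close>
  have "\<exists>i<q. (i, to_circle c) \<in> M"
  proof (rule ccontr)
    assume none: "\<not> ?thesis"
    have "\<exists>N U. open U \<and> (i, to_circle c) \<in> U \<and> (\<forall>n\<ge>N. (S ^^ n) x \<notin> U)" if "i < q" for i
    proof -
      have "(i, to_circle c) \<notin> omega_limit S x" using none that x(2) by blast
      then show ?thesis unfolding mem_omega_limit_iff by simp
    qed
    then obtain N U where NU: "\<And>i. i < q \<Longrightarrow> open (U i) \<and> (i, to_circle c) \<in> U i \<and> (\<forall>n\<ge>N i. (S ^^ n) x \<notin> U i)"
      by metis
    define W where "W = (\<Inter>i<q. Pair i -` U i)"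
    have "open (Pair i -` U i)" if "i < q" for i
      using NU[OF that] by (intro open_vimage continuous_intros) auto
    then have "open W" unfolding W_def by (intro open_INT) auto
    moreover have "to_circle c \<in> W" using NU by (auto simp: W_def)
    ultimately obtain n where n: "n \<ge> Max (N ` {..<q})" "snd x + to_circle (real n * \<alpha>) \<in> W"
      using circle_orbit_dense[of \<alpha> W "to_circle c" "Max (N ` {..<q})" "snd x"] irr unfolding \<alpha>_def by blast
    define i where "i = fst ((S ^^ n) x)"
    have i: "i < q" unfolding i_def S_def by (rule fst_itm_funpow_less) fact+
    have "(S ^^ n) x = (i, snd x + to_circle (real n * \<alpha>))"
      using snd_itm_funpow[of n p q b \<theta> x] by (simp add: prod_eq_iff i_def S_def \<alpha>_def)
    then have "(S ^^ n) x \<in> U i" using n(2) i by (auto simp: W_def)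
    moreover have "N i \<le> n" using n(1) i by (meson Max_ge finite_imageI finite_lessThan imageI lessThan_iff order_trans)
    ultimately show False using NU[OF i] by blast
  qed
  then obtain i where i: "i < q" "(i, to_circle c) \<in> M" by blast
  \<comment> \<open>The orbit never meets an end of the arc, so every step takes place at a
    continuity point and remains in the limit set.\<close>
  have "(S ^^ n) (i, to_circle c) \<in> M" for n
  proof (induction n)
    case (Suc n)
    define j where "j = fst ((S ^^ n) (i, to_circle c))"
    have eq: "(S ^^ n) (i, to_circle c) = (j, to_circle (c + real n * \<alpha>))"
      using snd_itm_funpow[of n p q b \<theta> "(i, to_circle c)"]
      by (simp add: prod_eq_iff j_def S_def \<alpha>_def to_circle_add)
    have "S (j, to_circle (c + real n * \<alpha>)) \<in> omega_limit S x"
    proof (rule omega_limit_step)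
      show "(j, to_circle (c + real n * \<alpha>)) \<in> omega_limit S x" using Suc eq x by simp
      show "\<exists>U. open U \<and> (j, to_circle (c + real n * \<alpha>)) \<in> U \<and> S ` U \<subseteq> V"
        if "open V" "S (j, to_circle (c + real n * \<alpha>)) \<in> V" for V
        using itm_locally_continuous[OF c that(1)] that(2) by (simp add: S_def \<alpha>_def)
    qed
    then show ?case using eq x by simp
  qed (use i in simp)
  then have "closure (range (\<lambda>n. (S ^^ n) (i, to_circle c))) \<subseteq> M"
    unfolding x(2) by (intro closure_minimal closed_omega_limit) auto
  then show ?thesis using dense[OF i(2)] i(1) unfolding S_def by blast
qed

lemma minimal_components_bound:
  assumes "p < q" "tan \<theta> / real q \<notin> \<rat>"
  shows "finite {M. minimal_component (sections q) (itm p q b \<theta>) M} \<and>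
    card {M. minimal_component (sections q) (itm p q b \<theta>) M} \<le> q"
proof -
  obtain c where c: "\<And>n. tent (c + real n * (tan \<theta> / real q)) \<noteq> b" using generic_point_exists by metis
  define f where "f i = closure (range (\<lambda>n. (itm p q b \<theta> ^^ n) (i, to_circle c)))" for i
  have sub: "{M. minimal_component (sections q) (itm p q b \<theta>) M} \<subseteq> f ` {..<q}"
    using minimal_component_orbit_closure[OF assms c] by (auto simp: f_def)
  have "card (f ` {..<q}) \<le> q" using card_image_le[of "{..<q}" f] by simp
  then show ?thesis using sub by (meson card_mono finite_imageI finite_lessThan finite_subset order_trans)
qed

section \<open>Counting ergodic measures\<close>

lemma itm_measurable: "itm p q b \<theta> \<in> borel \<rightarrow>\<^sub>M borel"
proof -
  define \<tau> where "\<tau> = to_circle (tan \<theta> / real q)"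
  define K :: "(nat \<times> circle) set" where "K = fst -` {q - p} \<inter> snd -` (to_circle ` {-b..b})"
  have "closed K"
    unfolding K_def using closed_arc
    by (intro closed_Int closed_vimage continuous_intros) (auto simp: closed_def Topological_Spaces.open_discrete)
  have snd: "continuous_on UNIV (\<lambda>z :: nat \<times> circle. snd z + \<tau>)"
    by (rule continuous_on_compose2[OF continuous_on_circle_translate continuous_on_snd]) (auto intro: continuous_intros)
  have "continuous_on UNIV (\<lambda>n. (n + 1) mod q)"
    by (simp add: continuous_on_open_vimage Topological_Spaces.open_discrete)
  then have "continuous_on UNIV (\<lambda>z :: nat \<times> circle. (fst z + 1) mod q)"
    by (rule continuous_on_compose2) (auto intro: continuous_intros)
  then have "(\<lambda>z. ((fst z + 1) mod q, snd z + \<tau>)) \<in> borel \<rightarrow>\<^sub>M borel"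
    by (intro borel_measurable_continuous_onI continuous_on_Pair snd)
  moreover have "(\<lambda>z :: nat \<times> circle. (p, snd z + \<tau>)) \<in> borel \<rightarrow>\<^sub>M borel"
    by (intro borel_measurable_continuous_onI continuous_on_Pair snd continuous_on_const)
  ultimately have "(\<lambda>z. if z \<in> K then (p, snd z + \<tau>) else ((fst z + 1) mod q, snd z + \<tau>)) \<in> borel \<rightarrow>\<^sub>M borel"
    using borel_closed[OF \<open>closed K\<close>] by (intro measurable_If_set) auto
  also have "(\<lambda>z. if z \<in> K then (p, snd z + \<tau>) else ((fst z + 1) mod q, snd z + \<tau>)) = itm p q b \<theta>"
    by (auto simp: fun_eq_iff itm_def K_def \<tau>_def)
  finally show ?thesis .
qed

lemma snd_borel_measurable: "(snd :: 'a :: topological_space \<times> 'b :: topological_space \<Rightarrow> 'b) \<in> borel \<rightarrow>\<^sub>M borel"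
  by (intro borel_measurable_continuous_onI continuous_intros)

text \<open>\<open>snd\<close> semiconjugates the map to the rotation, so both image measures are
  invariant under an irrational rotation and unique ergodicity applies.\<close>

lemma itm_projection_unique:
  assumes irr: "tan \<theta> / real q \<notin> \<rat>"
    and "invariant_measure (itm p q b \<theta>) \<mu>" "invariant_measure (itm p q b \<theta>) \<mu>'"
  shows "distr \<mu> borel snd = distr \<mu>' borel snd"
proof -
  define R where "R = (\<lambda>y. y + to_circle (tan \<theta> / real q))"
  have R [measurable]: "R \<in> borel \<rightarrow>\<^sub>M borel"
    unfolding R_def by (intro borel_measurable_continuous_onI continuous_on_circle_translate)
  have proj: "prob_space (distr \<mu> borel snd) \<and> distr (distr \<mu> borel snd) borel R = distr \<mu> borel snd"
    if \<mu>: "invariant_measure (itm p q b \<theta>) \<mu>" for \<mu>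
  proof
    have sets: "sets \<mu> = sets borel" and "prob_space \<mu>"
      and inv: "\<And>A. A \<in> sets borel \<Longrightarrow> emeasure \<mu> (itm p q b \<theta> -` A) = emeasure \<mu> A"
      using \<mu> by (auto simp: invariant_measure_def)
    have sp: "space \<mu> = UNIV" using sets_eq_imp_space_eq[OF sets] by simp
    have m: "snd \<in> \<mu> \<rightarrow>\<^sub>M borel"
      unfolding measurable_cong_sets[OF sets refl] by (rule snd_borel_measurable)
    show "prob_space (distr \<mu> borel snd)" using \<open>prob_space \<mu>\<close> m by (rule prob_space.prob_space_distr)
    show "distr (distr \<mu> borel snd) borel R = distr \<mu> borel snd"
    proof (rule measure_eqI)
      fix A assume "A \<in> sets (distr (distr \<mu> borel snd) borel R)"
      then have A: "A \<in> sets borel" by simp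
      have RA: "R -` A \<in> sets borel" using measurable_sets[OF R A] by simp
      have A': "snd -` A \<in> sets (borel :: (nat \<times> circle) measure)"
        using measurable_sets[OF snd_borel_measurable A] by simp
      have "emeasure (distr (distr \<mu> borel snd) borel R) A = emeasure \<mu> (snd -` (R -` A))"
        using A RA m by (simp add: emeasure_distr sp)
      also have "snd -` (R -` A) = itm p q b \<theta> -` (snd -` A)" by (simp add: vimage_def R_def snd_itm)
      also have "emeasure \<mu> \<dots> = emeasure \<mu> (snd -` A)" using inv[OF A'] .
      also have "\<dots> = emeasure (distr \<mu> borel snd) A" using A m by (simp add: emeasure_distr sp)
      finally show "emeasure (distr (distr \<mu> borel snd) borel R) A = emeasure (distr \<mu> borel snd) A" .
    qed simp
  qed
  show ?thesis
    using rotation_uniquely_ergodic[OF irr, of "distr \<mu> borel snd" "distr \<mu>' borel snd"]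
      proj[OF assms(2)] proj[OF assms(3)] unfolding R_def by simp
qed

lemma ergodic_measures_bound:
  assumes pq: "p < q" and irr: "tan \<theta> / real q \<notin> \<rat>"
  shows "finite {\<mu>. ergodic_measure (itm p q b \<theta>) \<mu>} \<and> card {\<mu>. ergodic_measure (itm p q b \<theta>) \<mu>} \<le> q"
proof (rule finite_if_finite_subsets_card_bdd)
  define S where "S = itm p q b \<theta>"
  \<comment> \<open>A bound on all finite subfamilies gives finiteness and the cardinality at once,
    and only finitely many almost sure statements have to be combined.\<close>
  fix F assume "F \<subseteq> {\<mu>. ergodic_measure (itm p q b \<theta>) \<mu>}" and fin: "finite F"
  then have erg: "\<And>\<mu>. \<mu> \<in> F \<Longrightarrow> ergodic_measure S \<mu>" by (auto simp: S_def)
  have S_meas: "S \<in> borel \<rightarrow>\<^sub>M borel" unfolding S_def by (rule itm_measurable)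
  show "card F \<le> q"
  proof (cases "F = {}")
    case False
    then obtain \<mu>0 where \<mu>0: "\<mu>0 \<in> F" by blast
    define \<nu> where "\<nu> = distr \<mu>0 borel snd"
    have "\<forall>\<mu>\<in>F. \<forall>\<mu>'\<in>F. \<mu> \<noteq> \<mu>' \<longrightarrow> (\<exists>A\<in>sets borel. emeasure \<mu> A = 1 \<and> emeasure \<mu>' A = 0)"
      using ergodic_measures_separated[OF S_meas] erg by blast
    then obtain B where B: "\<And>\<mu> \<mu>'. \<mu> \<in> F \<Longrightarrow> \<mu>' \<in> F \<Longrightarrow> \<mu> \<noteq> \<mu>' \<Longrightarrow>
        B \<mu> \<mu>' \<in> sets borel \<and> emeasure \<mu> (B \<mu> \<mu>') = 1 \<and> emeasure \<mu>' (B \<mu> \<mu>') = 0"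
      by metis
    \<comment> \<open>Keeping the sets on which \<mu> wins and removing those on which a competitor
      wins makes these sets pairwise disjoint, while each still has full measure for its own
      \<mu>.\<close>
    define A where "A \<mu> = {z. fst z < q \<and> (\<forall>\<mu>'\<in>F - {\<mu>}. z \<in> B \<mu> \<mu>' - B \<mu>' \<mu>)}" for \<mu>
    define P where "P \<mu> = {y. \<exists>i. (i, y) \<in> A \<mu>}" for \<mu>
    have disj: "\<mu> = \<mu>'" if "z \<in> A \<mu>" "z \<in> A \<mu>'" "\<mu> \<in> F" "\<mu>' \<in> F" for z \<mu> \<mu>'
      using that by (auto simp: A_def)
    have "AE y in \<nu>. y \<in> P \<mu>" if \<mu>: "\<mu> \<in> F" for \<mu>
    proof -
      have sets: "sets \<mu> = sets borel" and "prob_space \<mu>"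
        and inv: "\<And>A. A \<in> sets borel \<Longrightarrow> emeasure \<mu> (S -` A) = emeasure \<mu> A"
        using erg[OF \<mu>] by (auto simp: ergodic_measure_def invariant_measure_def)
      interpret prob_space \<mu> by fact
      have sp: "space \<mu> = UNIV" using sets_eq_imp_space_eq[OF sets] by simp
      have m: "snd \<in> \<mu> \<rightarrow>\<^sub>M borel"
        unfolding measurable_cong_sets[OF sets refl] by (rule snd_borel_measurable)
      \<comment> \<open>The measures are given on all of \<open>nat \<times> circle\<close>. The map
        sends every point into the \<open>q\<close> sections, so invariance gives them full
        mass.\<close>
      define Q :: "(nat \<times> circle) set" where "Q = {..<q} \<times> UNIV"
      have Q: "Q \<in> sets borel" unfolding Q_def by (intro borel_open open_Times Topological_Spaces.open_discrete open_UNIV)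
      have "S -` Q = space \<mu>" using fst_itm_less[OF pq] by (auto simp: Q_def S_def mem_Times_iff sp)
      then have "emeasure \<mu> Q = 1" using inv[OF Q] emeasure_space_1 by simp
      then have "AE z in \<mu>. z \<in> Q" using Q sets by (simp add: AE_in_set_eq_1 emeasure_eq_measure)
      moreover have "AE z in \<mu>. z \<in> B \<mu> \<mu>' - B \<mu>' \<mu>" if "\<mu>' \<in> F - {\<mu>}" for \<mu>'
      proof -
        have "AE z in \<mu>. z \<in> B \<mu> \<mu>'"
          using B[of \<mu> \<mu>'] \<mu> that sets by (auto simp: AE_in_set_eq_1 emeasure_eq_measure)
        moreover have "AE z in \<mu>. z \<notin> B \<mu>' \<mu>"
          using B[of \<mu>' \<mu>] \<mu> that sets by (intro AE_not_in null_setsI) auto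
        ultimately show ?thesis by eventually_elim simp
      qed
      then have "AE z in \<mu>. \<forall>\<mu>'\<in>F - {\<mu>}. z \<in> B \<mu> \<mu>' - B \<mu>' \<mu>"
        using fin by (intro AE_finite_allI) auto
      ultimately have AE: "AE z in \<mu>. z \<in> A \<mu>"
        by eventually_elim (auto simp: A_def Q_def)
      have "(\<Inter>\<mu>'\<in>F - {\<mu>}. B \<mu> \<mu>' - B \<mu>' \<mu>) \<in> sets borel" if "F - {\<mu>} \<noteq> {}"
        using B \<mu> fin that by (intro sets.finite_INT sets.Diff) auto
      moreover have "A \<mu> = Q \<inter> (\<Inter>\<mu>'\<in>F - {\<mu>}. B \<mu> \<mu>' - B \<mu>' \<mu>)" by (auto simp: A_def Q_def)
      ultimately have "A \<mu> \<in> sets borel" using Q by (cases "F - {\<mu>} = {}") (auto intro!: sets.Int)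
      \<comment> \<open>The projection of a Borel set need not be Borel in general; here it is a
        countable union of Borel slices.\<close>
      moreover have "Pair i \<in> borel \<rightarrow>\<^sub>M (borel :: (nat \<times> circle) measure)" for i
        by (intro borel_measurable_continuous_onI continuous_intros)
      ultimately have "Pair i -` A \<mu> \<in> sets borel" for i
        using measurable_sets[of "Pair i" borel borel "A \<mu>"] by simp
      then have "(\<Union>i. Pair i -` A \<mu>) \<in> sets borel" by (intro sets.countable_UN) auto
      also have "(\<Union>i. Pair i -` A \<mu>) = P \<mu>" by (auto simp: P_def)
      finally have P: "P \<mu> \<in> sets borel" .
      have "AE z in \<mu>. snd z \<in> P \<mu>" using AE by eventually_elim (auto simp: P_def)
      then have "AE y in distr \<mu> borel snd. y \<in> P \<mu>"
        using P by (subst AE_distr_iff[OF m]) auto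
      also have "distr \<mu> borel snd = \<nu>"
        using itm_projection_unique[OF irr, of p b \<mu> \<mu>0] erg[OF \<mu>] erg[OF \<mu>0]
        by (simp add: \<nu>_def ergodic_measure_def S_def)
      finally show ?thesis .
    qed
    then have AE: "AE y in \<nu>. \<forall>\<mu>\<in>F. y \<in> P \<mu>" using fin by (intro AE_finite_allI) auto
    have "prob_space \<nu>"
    proof -
      have sets: "sets \<mu>0 = sets borel" and "prob_space \<mu>0"
        using erg[OF \<mu>0] by (auto simp: ergodic_measure_def invariant_measure_def)
      have "snd \<in> \<mu>0 \<rightarrow>\<^sub>M borel"
        unfolding measurable_cong_sets[OF sets refl] by (rule snd_borel_measurable)
      then show ?thesis unfolding \<nu>_def using \<open>prob_space \<mu>0\<close> by (rule prob_space.prob_space_distr[rotated])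
    qed
    \<comment> \<open>All projections have full measure for the same \<nu>, so one fibre meets every
      \<open>A \<mu>\<close>. Disjointness turns the choice of a fibre point into an injection of
      \<open>F\<close> into the \<open>q\<close> indices.\<close>
    have "\<exists>y. \<forall>\<mu>\<in>F. y \<in> P \<mu>"
    proof (rule ccontr)
      assume "\<not> ?thesis"
      then have "AE y in \<nu>. \<not> (\<forall>\<mu>\<in>F. y \<in> P \<mu>)" by (intro AE_I2) simp
      then show False by (rule prob_space.AE_contr[OF \<open>prob_space \<nu>\<close> AE])
    qed
    then obtain y where "\<forall>\<mu>\<in>F. y \<in> P \<mu>" ..
    then have "\<forall>\<mu>\<in>F. \<exists>i. (i, y) \<in> A \<mu>" by (simp add: P_def)
    then obtain f where f: "\<And>\<mu>. \<mu> \<in> F \<Longrightarrow> (f \<mu>, y) \<in> A \<mu>" by metis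
    have "inj_on f F" using f disj by (metis inj_onI)
    moreover have "f ` F \<subseteq> {..<q}" using f by (force simp: A_def)
    ultimately show ?thesis using card_inj_on_le[of f F "{..<q}"] by simp
  qed simp
qed

theorem corollary10:
  fixes p q :: nat and a b \<theta> :: real
  assumes "p > 0" and "q > 0"
    and "a = real p / real q" and "0 < a" and "a < 1/2"
    and "0 < b" and "b < 1/2"
    and "\<not> exceptional a b \<theta>"
  shows "finite {M. minimal_component (sections q) (itm p q b \<theta>) M} \<and>
         card {M. minimal_component (sections q) (itm p q b \<theta>) M} \<le> q \<and>
         (\<forall>M. minimal_component (sections q) (itm p q b \<theta>) M \<longrightarrow>
            finite (ergodic_measures_on (itm p q b \<theta>) M) \<and>
            card (ergodic_measures_on (itm p q b \<theta>) M) \<le> 1 + 2 * q)"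
proof -
  have "a \<in> \<rat>" using assms(3) by simp
  then have "tan \<theta> \<notin> \<rat>" using exceptional_if_tan_rational assms by blast
  then have irr: "tan \<theta> / real q \<notin> \<rat>"
    using Rats_mult[of "tan \<theta> / real q" "real q"] assms(2) by auto
  have pq: "p < q" using assms(2,3,5) by (simp add: divide_less_eq)
  have "finite (ergodic_measures_on (itm p q b \<theta>) M) \<and> card (ergodic_measures_on (itm p q b \<theta>) M) \<le> 1 + 2 * q" for M
  proof -
    have sub: "ergodic_measures_on (itm p q b \<theta>) M \<subseteq> {\<mu>. ergodic_measure (itm p q b \<theta>) \<mu>}"
      by (auto simp: ergodic_measures_on_def)
    have "finite {\<mu>. ergodic_measure (itm p q b \<theta>) \<mu>}" "card {\<mu>. ergodic_measure (itm p q b \<theta>) \<mu>} \<le> q"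
      using ergodic_measures_bound[OF pq irr] by auto
    then show ?thesis using sub finite_subset[OF sub] card_mono[OF _ sub] by auto
  qed
  then show ?thesis using minimal_components_bound[OF pq irr] by blast
qed

end
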